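(* Let $k$ be a positive integer and let $\mu$ be a probability measure on $\Omega$ satisfying (Ak1), (Ak2) and (A4). Then $\mu$-almost surely there is at most one infinite primal contour.
   Context: Let $G$ be the square grid with vertex set $\mathbb{Z}^2$ and nearest-neighbour edges. The face of $G$ with lower-left corner $(m,n)$ is black if $m+n$ is even, white otherwise. $\Omega\subset\{0,1\}^{\mathbb{Z}^2}$ is the set of $\omega$ such that for every black face the states of its four vertices, listed clockwise from the lower-left corner, form one of $0000,1111,0011,1100,0110,1001$. Let $\mathbb{L}_1$ be the graph with vertices $(m-\tfrac12,n+\tfrac12)$, $m,n$ both even, and $\mathbb{L}_2$ the graph with vertices $(m-\tfrac12,n+\tfrac12)$, $m,n$ both odd; in each, two vertices are joined by an edge iff at Euclidean distance $2$. The center of each black face $F$ is the midpoint of exactly one edge $e_1$ of $\mathbb{L}_1$ and one edge $e_2$ of $\mathbb{L}_2$ (perpendicular). For $\omega\in\Omega$ define $\phi(\omega)\in\{0,1\}^{E(\mathbb{L}_1)\cup E(\mathbb{L}_2)}$: if the configuration around $F$ is $0000$ or $1111$ both $e_1,e_2$ get $0$; if the two upper vertices share a state different from the two lower ones, the horizontal one of $e_1,e_2$ gets $1$, the vertical $0$; if the two left vertices share a state different from the two right ones, the vertical one gets $1$, the horizontal $0$. Edges with value $1$ are present; a contour is a connected component of the set of present edges; a primal contour is one consisting of edges of $\mathbb{L}_1$; it is infinite if it has infinitely many edges. Assumptions on $\mu$: (Ak1) $\mu$ is invariant under translations by $2k\mathbb{Z}\times2k\mathbb{Z}$; (Ak2)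 every $2k\mathbb{Z}\times2k\mathbb{Z}$-translation-invariant event has $\mu$-probability $0$ or $1$; (A4) if $\nu_1$ is the law of the restriction of $\phi(\omega)$ to $E(\mathbb{L}_1)$, then for every face $S$ of $\mathbb{L}_1$ and every event $E$ with $\nu_1(E)>0$ we have $\nu_1(E_S)>0$, where $E_S=\{\psi_S:\psi\in E\}$ and $\psi_S$ is obtained from $\psi$ by flipping the states of the four sides of $S$. *)

theory Defs
  imports "HOL-Probability.Probability"
begin

type_synonym config = "int \<times> int \<Rightarrow> bool"   (* True = state 1, False = state 0 *)

text \<open>Black face with lower-left corner (a,b): a+b even. Its four vertices listed
clockwise from the lower-left corner are (a,b), (a,b+1), (a+1,b+1), (a+1,b).\<close>

definition black_face :: "int \<times> int \<Rightarrow> bool" where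
  "black_face F \<longleftrightarrow> even (fst F + snd F)"

definition face_states :: "config \<Rightarrow> int \<times> int \<Rightarrow> bool list" where
  "face_states \<omega> F = (case F of (a,b) \<Rightarrow> [\<omega> (a,b), \<omega> (a,b+1), \<omega> (a+1,b+1), \<omega> (a+1,b)])"

definition Omega :: "config set" where
  "Omega = {\<omega>. \<forall>F. black_face F \<longrightarrow> face_states \<omega> F \<in>
      {[False,False,False,False], [True,True,True,True], [False,False,True,True],
       [True,True,False,False], [False,True,True,False], [True,False,False,True]}}"

definition config_space :: "config measure" where
  "config_space = Pi\<^sub>M UNIV (\<lambda>_. count_space UNIV)"

text \<open>Convention: the integer pair (m,n) stands for the point (m - 1/2, n + 1/2) of the plane.
L1 vertices: m, n both even; L2 vertices: m, n both odd. Edges are two-element sets of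
such index pairs at Euclidean distance 2 (distance is translation invariant).\<close>

definition L1_vertex :: "int \<times> int \<Rightarrow> bool" where
  "L1_vertex v \<longleftrightarrow> even (fst v) \<and> even (snd v)"

definition L2_vertex :: "int \<times> int \<Rightarrow> bool" where
  "L2_vertex v \<longleftrightarrow> odd (fst v) \<and> odd (snd v)"

definition dist2 :: "int \<times> int \<Rightarrow> int \<times> int \<Rightarrow> bool" where
  "dist2 u v \<longleftrightarrow> (fst u - fst v)^2 + (snd u - snd v)^2 = 4"

definition L1_edges :: "(int \<times> int) set set" where
  "L1_edges = {{u, v} | u v. L1_vertex u \<and> L1_vertex v \<and> dist2 u v}"

definition L2_edges :: "(int \<times> int) set set" where
  "L2_edges = {{u, v} | u v. L2_vertex u \<and> L2_vertex v \<and> dist2 u v}"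

text \<open>For the black face with lower-left corner (a,b) (centre (a+1/2,b+1/2)):
the horizontal edge with midpoint the centre is {(a,b),(a+2,b)}, the vertical
one is {(a+1,b-1),(a+1,b+1)} (in index coordinates).\<close>

definition hedge :: "int \<times> int \<Rightarrow> (int \<times> int) set" where
  "hedge F = (case F of (a,b) \<Rightarrow> {(a,b), (a+2,b)})"

definition vedge :: "int \<times> int \<Rightarrow> (int \<times> int) set" where
  "vedge F = (case F of (a,b) \<Rightarrow> {(a+1,b-1), (a+1,b+1)})"

definition tb_split :: "config \<Rightarrow> int \<times> int \<Rightarrow> bool" where
  "tb_split \<omega> F = (case F of (a,b) \<Rightarrow>
     \<omega> (a,b+1) = \<omega> (a+1,b+1) \<and> \<omega> (a,b) = \<omega> (a+1,b) \<and> \<omega> (a,b) \<noteq> \<omega> (a,b+1))"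

definition lr_split :: "config \<Rightarrow> int \<times> int \<Rightarrow> bool" where
  "lr_split \<omega> F = (case F of (a,b) \<Rightarrow>
     \<omega> (a,b) = \<omega> (a,b+1) \<and> \<omega> (a+1,b) = \<omega> (a+1,b+1) \<and> \<omega> (a,b) \<noteq> \<omega> (a+1,b))"

definition phi :: "config \<Rightarrow> (int \<times> int) set \<Rightarrow> bool" where
  "phi \<omega> e \<longleftrightarrow> (\<exists>F. black_face F \<and>
      ((e = hedge F \<and> tb_split \<omega> F) \<or> (e = vedge F \<and> lr_split \<omega> F)))"

definition present_edges :: "config \<Rightarrow> (int \<times> int) set set" where
  "present_edges \<omega> = {e. (e \<in> L1_edges \<or> e \<in> L2_edges) \<and> phi \<omega> e}"

definition edge_adj :: "config \<Rightarrow> ((int \<times> int) set \<times> (int \<times> int) set) set" where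
  "edge_adj \<omega> = {(e, e'). e \<in> present_edges \<omega> \<and> e' \<in> present_edges \<omega> \<and> e \<inter> e' \<noteq> {}}"

definition contour :: "config \<Rightarrow> (int \<times> int) set set \<Rightarrow> bool" where
  "contour \<omega> C \<longleftrightarrow> (\<exists>e \<in> present_edges \<omega>. C = {e'. (e, e') \<in> (edge_adj \<omega>)\<^sup>*})"

definition infinite_primal_contour :: "config \<Rightarrow> (int \<times> int) set set \<Rightarrow> bool" where
  "infinite_primal_contour \<omega> C \<longleftrightarrow> contour \<omega> C \<and> C \<subseteq> L1_edges \<and> infinite C"

definition shift :: "int \<times> int \<Rightarrow> config \<Rightarrow> config" where
  "shift t \<omega> = (\<lambda>(x,y). \<omega> (x + fst t, y + snd t))"

definition Ak1 :: "nat \<Rightarrow> config measure \<Rightarrow> bool" where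
  "Ak1 k \<mu> \<longleftrightarrow> (\<forall>i j. \<forall>A \<in> sets \<mu>.
     emeasure \<mu> (shift (2 * int k * i, 2 * int k * j) -` A \<inter> space \<mu>) = emeasure \<mu> A)"

definition Ak2 :: "nat \<Rightarrow> config measure \<Rightarrow> bool" where
  "Ak2 k \<mu> \<longleftrightarrow> (\<forall>A \<in> sets \<mu>.
     (\<forall>i j. shift (2 * int k * i, 2 * int k * j) -` A \<inter> space \<mu> = A) \<longrightarrow>
     emeasure \<mu> A = 0 \<or> emeasure \<mu> A = 1)"

definition L1_conf_space :: "((int \<times> int) set \<Rightarrow> bool) measure" where
  "L1_conf_space = Pi\<^sub>M L1_edges (\<lambda>_. count_space UNIV)"

definition nu1 :: "config measure \<Rightarrow> ((int \<times> int) set \<Rightarrow> bool) measure" where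
  "nu1 \<mu> = distr \<mu> L1_conf_space (\<lambda>\<omega>. restrict (phi \<omega>) L1_edges)"

definition L1_face_sides :: "int \<times> int \<Rightarrow> (int \<times> int) set set" where
  "L1_face_sides S = (case S of (m,n) \<Rightarrow>
     {{(m,n),(m+2,n)}, {(m,n+2),(m+2,n+2)}, {(m,n),(m,n+2)}, {(m+2,n),(m+2,n+2)}})"

definition flip_face :: "int \<times> int \<Rightarrow> ((int \<times> int) set \<Rightarrow> bool) \<Rightarrow> ((int \<times> int) set \<Rightarrow> bool)" where
  "flip_face S \<psi> = restrict (\<lambda>e. if e \<in> L1_face_sides S then \<not> \<psi> e else \<psi> e) L1_edges"

definition A4 :: "config measure \<Rightarrow> bool" where
  "A4 \<mu> \<longleftrightarrow> (\<forall>S E. L1_vertex S \<longrightarrow> E \<in> sets (nu1 \<mu>) \<longrightarrow> emeasure (nu1 \<mu>) E > 0 \<longrightarrow>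
     emeasure (nu1 \<mu>) (flip_face S ` E) > 0)"

end

(* Burton-Keane argument. The primal edges form a copy of the square lattice, on which the image of mu is
   an ergodic law of configurations with even degrees. Such a configuration is the set of domain
   walls of a two-colouring of the faces, and by (A4) the colouring of finitely many faces may be changed
   at will without leaving the events of positive probability. Whatever the outside, a large box can be
   recoloured so that all its vertices become connected inside it. If three infinite clusters had positive
   probability, the box would thus be a trifurcation with positive probability; by translation
   invariance the expected number of disjoint trifurcation boxes in a square would be proportional to its
   area, whereas it is at most the size of the boundary. So there are at most two infinite clusters.
   If there were two with positive probability, then there would almost surely be two by ergodicity, but
   recolouring a box that meets both merges them. *)

theory Submission
  imports Defs
begin

section \<open>Trifurcations in graphs\<close>

text \<open>Degrees stay even under every recolouring, so edges cannot be opened one at a time and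
  no vertex has exactly three edges. This is why a whole box takes the role of a single trifurcation
  point: once it is connected inside itself, no disjoint paths have to be routed to a centre, and
  the branches outside are untouched. The obstacle is the rim of the box, where the fixed colours
  outside leave the edges only partly free. The boxes are counted by deleting all of them at once:
  what remains has at least as many infinite components meeting the square as boxes were deleted,
  and each leaves the square through a boundary vertex of its own. The recolouring depends on the
  configuration but is one of finitely many, so nothing has to be chosen measurably.\<close>

definition avoiding :: "'a rel \<Rightarrow> 'a set \<Rightarrow> 'a rel" where
  "avoiding R B = R \<inter> (- B) \<times> (- B)"

lemma avoiding_subset: "avoiding R B \<subseteq> R"
  by (auto simp: avoiding_def)

lemma rtrancl_avoiding_subset: "(avoiding R B)\<^sup>* \<subseteq> R\<^sup>*"
  by (simp add: avoiding_subset rtrancl_mono)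

lemma rtrancl_avoiding_antimono: "B \<subseteq> B' \<Longrightarrow> (avoiding R B')\<^sup>* \<subseteq> (avoiding R B)\<^sup>*"
  by (rule rtrancl_mono) (auto simp: avoiding_def)

lemma sym_avoiding: "sym R \<Longrightarrow> sym (avoiding R B)"
  by (auto simp: avoiding_def sym_def)

lemma rtrancl_symD: "sym R \<Longrightarrow> (x, y) \<in> R\<^sup>* \<Longrightarrow> (y, x) \<in> R\<^sup>*"
  by (meson sym_rtrancl symD)

lemma rtrancl_avoiding_notin:
  assumes "(x, y) \<in> (avoiding R B)\<^sup>*" "x \<notin> B"
  shows "y \<notin> B"
  using assms by (induction rule: rtrancl_induct) (auto simp: avoiding_def)

text \<open>A path from \<open>x\<close> only uses steps between vertices reachable from
  \<open>x\<close>. This carries components over to a second graph that need only contain those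
  steps.\<close>

lemma rtrancl_restrict:
  assumes "(x, y) \<in> R\<^sup>*"
    and "\<And>z w. (x, z) \<in> R\<^sup>* \<Longrightarrow> (x, w) \<in> R\<^sup>* \<Longrightarrow> (z, w) \<in> R \<Longrightarrow> (z, w) \<in> S"
  shows "(x, y) \<in> S\<^sup>*"
  using assms(1)
proof (induction rule: rtrancl_induct)
  case (step y z)
  then show ?case using assms(2)[of y z] by (meson rtrancl.rtrancl_into_rtrancl)
qed simp

text \<open>The path is cut at its last visit to \<open>B\<close>.\<close>

lemma last_exit:
  assumes "(x, y) \<in> R\<^sup>*" "x \<in> B" "y \<notin> B"
  obtains b a where "b \<in> B" "a \<notin> B" "(b, a) \<in> R" "(x, b) \<in> R\<^sup>*" "(a, y) \<in> (avoiding R B)\<^sup>*"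
proof -
  have "y \<notin> B \<longrightarrow> (\<exists>b a. b \<in> B \<and> a \<notin> B \<and> (b, a) \<in> R \<and> (x, b) \<in> R\<^sup>* \<and> (a, y) \<in> (avoiding R B)\<^sup>*)"
    using assms(1)
  proof (induction rule: rtrancl_induct)
    case base
    then show ?case using assms(2) by simp
  next
    case (step y z)
    show ?case
    proof (intro impI)
      assume z: "z \<notin> B"
      show "\<exists>b a. b \<in> B \<and> a \<notin> B \<and> (b, a) \<in> R \<and> (x, b) \<in> R\<^sup>* \<and> (a, z) \<in> (avoiding R B)\<^sup>*"
      proof (cases "y \<in> B")
        case True
        then show ?thesis using z step by blast
      next
        case False
        then obtain b a where ba: "b \<in> B" "a \<notin> B" "(b, a) \<in> R" "(x, b) \<in> R\<^sup>*"
          "(a, y) \<in> (avoiding R B)\<^sup>*" using step.IH by blast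
        have "(y, z) \<in> avoiding R B" using False z step by (simp add: avoiding_def)
        then show ?thesis using ba by (meson rtrancl.rtrancl_into_rtrancl)
      qed
    qed
  qed
  then show thesis using assms that by blast
qed

text \<open>Cutting paths at their last visit to \<open>B\<close> covers the component of
  \<open>x\<close> by \<open>B\<close> and the branches at finitely many outside neighbours; one of
  these must be infinite.\<close>

lemma infinite_branch:
  assumes fin: "\<And>x. finite (R `` {x})" and "finite B" "x \<in> B" and inf: "infinite (R\<^sup>* `` {x})"
  obtains b a where "b \<in> B" "a \<notin> B" "(b, a) \<in> R" "(x, b) \<in> R\<^sup>*"
    "infinite ((avoiding R B)\<^sup>* `` {a})"
proof -
  define N where "N = {a. a \<notin> B \<and> (\<exists>b\<in>B. (b, a) \<in> R \<and> (x, b) \<in> R\<^sup>*)}"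
  have "N \<subseteq> (\<Union>b\<in>B. R `` {b})" by (auto simp: N_def)
  then have finN: "finite N" using fin \<open>finite B\<close> by (meson finite_UN_I finite_subset)
  have "R\<^sup>* `` {x} \<subseteq> B \<union> (\<Union>a\<in>N. (avoiding R B)\<^sup>* `` {a})"
  proof
    fix y assume y: "y \<in> R\<^sup>* `` {x}"
    show "y \<in> B \<union> (\<Union>a\<in>N. (avoiding R B)\<^sup>* `` {a})"
    proof (cases "y \<in> B")
      case False
      with y obtain b a where "b \<in> B" "a \<notin> B" "(b, a) \<in> R" "(x, b) \<in> R\<^sup>*"
        "(a, y) \<in> (avoiding R B)\<^sup>*" using last_exit[of x y R B] \<open>x \<in> B\<close> by auto
      then show ?thesis by (auto simp: N_def)
    qed simp
  qed
  then have "\<exists>a\<in>N. infinite ((avoiding R B)\<^sup>* `` {a})"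
    using inf finN \<open>finite B\<close> by (meson finite_UN_I finite_Un finite_subset)
  then show thesis using that by (auto simp: N_def)
qed

text \<open>The paths use edges inside \<open>B\<close> only, so they survive the deletion of
  anything disjoint from \<open>B\<close>.\<close>

definition connected_within :: "'a rel \<Rightarrow> 'a set \<Rightarrow> bool" where
  "connected_within R B \<longleftrightarrow> (\<forall>x\<in>B. \<forall>y\<in>B. (x, y) \<in> (R \<inter> B \<times> B)\<^sup>*)"

definition infinite_branch_at :: "'a rel \<Rightarrow> 'a set \<Rightarrow> 'a \<Rightarrow> bool" where
  "infinite_branch_at R B a \<longleftrightarrow>
     a \<notin> B \<and> (\<exists>b\<in>B. (b, a) \<in> R) \<and> infinite ((avoiding R B)\<^sup>* `` {a})"

definition trifurcation :: "'a rel \<Rightarrow> 'a set \<Rightarrow> bool" where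
  "trifurcation R B \<longleftrightarrow> connected_within R B \<and>
     (\<exists>a b c. infinite_branch_at R B a \<and> infinite_branch_at R B b \<and> infinite_branch_at R B c \<and>
        (a, b) \<notin> (avoiding R B)\<^sup>* \<and> (a, c) \<notin> (avoiding R B)\<^sup>* \<and> (b, c) \<notin> (avoiding R B)\<^sup>*)"

lemma connected_within_avoiding:
  assumes "connected_within R B" "B \<inter> A = {}" "x \<in> B" "y \<in> B"
  shows "(x, y) \<in> (avoiding R A)\<^sup>*"
proof -
  have "(R \<inter> B \<times> B)\<^sup>* \<subseteq> (avoiding R A)\<^sup>*"
    using assms(2) by (intro rtrancl_mono) (auto simp: avoiding_def)
  then show ?thesis using assms by (auto simp: connected_within_def)
qed

text \<open>A pair (t, d) maximising the number of sets met by the component of d works: a set outside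
  that component would see it, together with B t, inside a single component.\<close>

lemma leaf_exists:
  fixes B :: "'t \<Rightarrow> 'a set"
  assumes R: "sym R" and T: "finite T" "T \<noteq> {}"
    and disj: "\<And>s t. s \<in> T \<Longrightarrow> t \<in> T \<Longrightarrow> s \<noteq> t \<Longrightarrow> B s \<inter> B t = {}"
    and conn: "\<And>t. t \<in> T \<Longrightarrow> connected_within R (B t)"
    and branch: "\<And>t. t \<in> T \<Longrightarrow> \<exists>a. infinite_branch_at R (B t) a"
  shows "\<exists>t\<in>T. \<exists>d. \<forall>s\<in>T - {t}. \<forall>b\<in>B s. \<forall>x\<in>B t.
           (x, b) \<in> R\<^sup>* \<longrightarrow> (d, b) \<in> (avoiding R (B t))\<^sup>*"
proof -
  \<comment> \<open>The component of \<open>d\<close> need not be infinite, and \<open>d\<close> may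
    lie in another of the sets: the competitor \<open>(s, a)\<close> below comes with no more than
    this.\<close>
  define Q where "Q = (\<lambda>(t, d). t \<in> T \<and> d \<notin> B t \<and> (\<exists>b\<in>B t. (b, d) \<in> R))"
  define S where "S = (\<lambda>(t, d). {s \<in> T. \<exists>b\<in>B s. (d, b) \<in> (avoiding R (B t))\<^sup>*})"
  have finS: "finite (S p)" for p using T(1) by (auto simp: S_def split: prod.splits)
  have "card (S p) \<le> card T" for p
    by (rule card_mono[OF T(1)]) (auto simp: S_def split: prod.splits)
  then have bound: "card (S p) < Suc (card T)" for p by (simp add: le_imp_less_Suc)
  obtain t0 where t0: "t0 \<in> T" using T by blast
  obtain a0 where "infinite_branch_at R (B t0) a0" using branch[OF t0] by blast
  then have "Q (t0, a0)" using t0 by (auto simp: Q_def infinite_branch_at_def)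
  then obtain p where p: "Q p" "\<And>q. Q q \<Longrightarrow> card (S q) \<le> card (S p)"
    using ex_has_greatest_nat[of Q "(t0, a0)" "\<lambda>p. card (S p)" "Suc (card T)"] bound by blast
  obtain t d where td: "p = (t, d)" by (cases p)
  have t: "t \<in> T" and d: "d \<notin> B t" and "\<exists>b\<in>B t. (b, d) \<in> R" using p(1) by (auto simp: Q_def td)
  then obtain x' where x': "x' \<in> B t" "(x', d) \<in> R" by blast
  have "(d, b) \<in> (avoiding R (B t))\<^sup>*"
    if s: "s \<in> T" "s \<noteq> t" and b: "b \<in> B s" and x: "x \<in> B t" and xb: "(x, b) \<in> R\<^sup>*" for s b x
  proof (rule ccontr)
    assume nd: "(d, b) \<notin> (avoiding R (B t))\<^sup>*"
    have dis: "B s \<inter> B t = {}" "B t \<inter> B s = {}" using disj s t by blast+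
    have "(b, x) \<in> R\<^sup>*" using xb R rtrancl_symD by metis
    moreover have "x \<notin> B s" using x dis by blast
    ultimately obtain b' a where ba: "b' \<in> B s" "a \<notin> B s" "(b', a) \<in> R" "(a, x) \<in> (avoiding R (B s))\<^sup>*"
      using last_exit[of b x R "B s"] b by metis
    have "Q (s, a)" using ba s by (auto simp: Q_def)
    \<comment> \<open>The component of \<open>d\<close> misses \<open>B s\<close>, for otherwise it
      would continue inside \<open>B s\<close> to \<open>b\<close>. So it persists when
      \<open>B s\<close> is deleted instead of \<open>B t\<close>, and is then joined through
      \<open>B t\<close> to \<open>a\<close>. Hence \<open>(s, a)\<close> sees all that
      \<open>(t, d)\<close> sees, and \<open>t\<close> besides.\<close>
    have nz: "z \<notin> B s" if "(d, z) \<in> (avoiding R (B t))\<^sup>*" for z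
      using connected_within_avoiding[OF conn[OF s(1)] dis(1) _ b] that nd
      by (meson rtrancl_trans)
    have dn: "d \<notin> B s" using nz by blast
    have step: "(d, z) \<in> (avoiding R (B s))\<^sup>*" if "(d, z) \<in> (avoiding R (B t))\<^sup>*" for z
      using that by (rule rtrancl_restrict) (use nz in \<open>auto simp: avoiding_def\<close>)
    have "(x, x') \<in> (avoiding R (B s))\<^sup>*"
      using connected_within_avoiding[OF conn[OF t] dis(2) x x'(1)] .
    moreover have "(x', d) \<in> avoiding R (B s)" using x' dn dis by (auto simp: avoiding_def)
    ultimately have ad: "(a, d) \<in> (avoiding R (B s))\<^sup>*" using ba(4)
      by (meson rtrancl.rtrancl_into_rtrancl rtrancl_trans)
    have "t \<notin> S (t, d)" using d rtrancl_avoiding_notin by (fastforce simp: S_def)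
    moreover have "t \<in> S (s, a)" using ba(4) x t by (auto simp: S_def)
    moreover have "S (t, d) \<subseteq> S (s, a)"
      using step ad by (auto simp: S_def) (meson rtrancl_trans)
    ultimately have "S (t, d) \<subset> S (s, a)" by blast
    then have "card (S (t, d)) < card (S (s, a))" using finS by (simp add: psubset_card_mono)
    then show False using p(2)[OF \<open>Q (s, a)\<close>] td by simp
  qed
  then show ?thesis using t by blast
qed

text \<open>Induction by removal of a leaf \<open>t\<close>. All other boxes connected with
  \<open>B t\<close> lie in the branch of \<open>d\<close>, so at least two of the three infinite
  branches contain no box. Deleting \<open>B t\<close> after the others loses at most one
  representative, that of the component containing \<open>B t\<close>, and gives two new ones, so
  the count grows by at least one. Representatives are neighbours of boxes and therefore lie in
  \<Lambda>.\<close>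

lemma trifurcations_separate:
  fixes B :: "'t \<Rightarrow> 'a set"
  assumes R: "sym R" and T: "finite T"
    and disj: "\<And>s t. s \<in> T \<Longrightarrow> t \<in> T \<Longrightarrow> s \<noteq> t \<Longrightarrow> B s \<inter> B t = {}"
    and tri: "\<And>t. t \<in> T \<Longrightarrow> trifurcation R (B t)"
    and nbr: "\<And>t. t \<in> T \<Longrightarrow> R `` B t \<subseteq> \<Lambda>"
  shows "\<exists>P. finite P \<and> P \<subseteq> \<Lambda> \<and> card T \<le> card P \<and>
    (\<forall>p\<in>P. infinite ((avoiding R (\<Union>(B ` T)))\<^sup>* `` {p})) \<and>
    (\<forall>p\<in>P. \<forall>q\<in>P. p \<noteq> q \<longrightarrow> (p, q) \<notin> (avoiding R (\<Union>(B ` T)))\<^sup>*)"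
  using T disj tri nbr
proof (induction T rule: finite_psubset_induct)
  case (psubset T)
  show ?case
  proof (cases "T = {}")
    case True
    then show ?thesis by (intro exI[of _ "{}"]) simp
  next
    case False
    have conn: "connected_within R (B t)" if "t \<in> T" for t
      using psubset.prems(2)[OF that] by (simp add: trifurcation_def)
    have branch: "\<exists>a. infinite_branch_at R (B t) a" if "t \<in> T" for t
      using psubset.prems(2)[OF that] by (auto simp: trifurcation_def)
    obtain t d where t: "t \<in> T" and leaf:
      "\<And>s b x. s \<in> T \<Longrightarrow> s \<noteq> t \<Longrightarrow> b \<in> B s \<Longrightarrow> x \<in> B t \<Longrightarrow> (x, b) \<in> R\<^sup>* \<Longrightarrow>
       (d, b) \<in> (avoiding R (B t))\<^sup>*"
      using leaf_exists[where B = B, OF R psubset.hyps(1) False psubset.prems(1) conn branch] by blast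
    let ?A = "avoiding R (B t)"
    define T' where "T' = T - {t}"
    define U U' where "U = \<Union>(B ` T)" and "U' = \<Union>(B ` T')"
    have U: "U = U' \<union> B t" using t by (auto simp: U_def U'_def T'_def)
    have disU: "B t \<inter> U' = {}" using psubset.prems(1) t by (fastforce simp: U'_def T'_def)
    have symA: "sym ?A" "sym (avoiding R U)" "sym (avoiding R U')" using R sym_avoiding by blast+
    obtain a b c where abc: "infinite_branch_at R (B t) a" "infinite_branch_at R (B t) b"
      "infinite_branch_at R (B t) c" "(a, b) \<notin> ?A\<^sup>*" "(a, c) \<notin> ?A\<^sup>*" "(b, c) \<notin> ?A\<^sup>*"
      using psubset.prems(2)[OF t] by (auto simp: trifurcation_def)
    have one: "(d, u) \<notin> ?A\<^sup>* \<or> (d, v) \<notin> ?A\<^sup>*" if "(u, v) \<notin> ?A\<^sup>*" for u v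
      using that rtrancl_symD[OF symA(1)] by (meson rtrancl_trans)
    obtain a1 a2 where a12: "infinite_branch_at R (B t) a1" "infinite_branch_at R (B t) a2"
      "(a1, a2) \<notin> ?A\<^sup>*" "(d, a1) \<notin> ?A\<^sup>*" "(d, a2) \<notin> ?A\<^sup>*"
      using abc one[OF abc(4)] one[OF abc(5)] one[OF abc(6)] by blast
    have stay: "(a', z) \<in> (avoiding R U)\<^sup>*"
      if a': "infinite_branch_at R (B t) a'" "(d, a') \<notin> ?A\<^sup>*" and z: "(a', z) \<in> ?A\<^sup>*" for a' z
    proof -
      obtain x where x: "x \<in> B t" "(x, a') \<in> R" "a' \<notin> B t" using a' by (auto simp: infinite_branch_at_def)
      have nU: "w \<notin> U'" if w: "(a', w) \<in> ?A\<^sup>*" for w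
      proof
        assume "w \<in> U'"
        then obtain s where s: "s \<in> T" "s \<noteq> t" "w \<in> B s" by (auto simp: U'_def T'_def)
        have "(x, w) \<in> R\<^sup>*" using x(2) w rtrancl_avoiding_subset
          by (metis converse_rtrancl_into_rtrancl subsetD)
        then have "(d, w) \<in> ?A\<^sup>*" using leaf s x by blast
        then show False using a'(2) w rtrancl_symD[OF symA(1)] by (meson rtrancl_trans)
      qed
      show ?thesis using z
        by (rule rtrancl_restrict) (use nU in \<open>auto simp: avoiding_def U\<close>)
    qed
    have a12notU': "a' \<notin> U'" if a': "infinite_branch_at R (B t) a'" "(d, a') \<notin> ?A\<^sup>*" for a'
    proof
      assume "a' \<in> U'"
      then obtain s where s: "s \<in> T" "s \<noteq> t" "a' \<in> B s" by (auto simp: U'_def T'_def)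
      obtain x where "x \<in> B t" "(x, a') \<in> R" using a' by (auto simp: infinite_branch_at_def)
      then show False using leaf[OF s] a'(2) by blast
    qed
    obtain x0 where x0: "x0 \<in> B t" using a12 by (auto simp: infinite_branch_at_def)
    \<comment> \<open>As long as \<open>B t\<close> is present, both new vertices hang on it; this
      shows them distinct and separated from the representatives that are kept.\<close>
    have to_x0: "(a', x0) \<in> (avoiding R U')\<^sup>*"
      if a': "infinite_branch_at R (B t) a'" "(d, a') \<notin> ?A\<^sup>*" for a'
    proof -
      obtain x where x: "x \<in> B t" "(x, a') \<in> R" using a' by (auto simp: infinite_branch_at_def)
      have "(a', x) \<in> avoiding R U'" using x disU a12notU'[OF a'] R by (auto simp: avoiding_def sym_def)
      moreover have "(x, x0) \<in> (avoiding R U')\<^sup>*"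
        using connected_within_avoiding[OF conn[OF t] disU x(1) x0] .
      ultimately show ?thesis by (meson converse_rtrancl_into_rtrancl)
    qed
    have "T' \<subset> T" using t by (auto simp: T'_def)
    then have "\<exists>P. finite P \<and> P \<subseteq> \<Lambda> \<and> card T' \<le> card P \<and>
      (\<forall>p\<in>P. infinite ((avoiding R U')\<^sup>* `` {p})) \<and>
      (\<forall>p\<in>P. \<forall>q\<in>P. p \<noteq> q \<longrightarrow> (p, q) \<notin> (avoiding R U')\<^sup>*)"
      unfolding U'_def
    proof (rule psubset.IH)
      fix s assume s: "s \<in> T'"
      then have sT: "s \<in> T" by (simp add: T'_def)
      show "trifurcation R (B s)" "R `` B s \<subseteq> \<Lambda>" using psubset.prems(2,3)[OF sT] by blast+
      fix u assume "u \<in> T'" "s \<noteq> u"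
      then show "B s \<inter> B u = {}" using psubset.prems(1)[OF sT] by (simp add: T'_def)
    qed
    then obtain P' where P': "finite P'" "P' \<subseteq> \<Lambda>" "card T' \<le> card P'"
      "\<And>p. p \<in> P' \<Longrightarrow> infinite ((avoiding R U')\<^sup>* `` {p})"
      "\<And>p q. p \<in> P' \<Longrightarrow> q \<in> P' \<Longrightarrow> p \<noteq> q \<Longrightarrow> (p, q) \<notin> (avoiding R U')\<^sup>*" by auto
    define Z where "Z = {p \<in> P'. (p, x0) \<in> (avoiding R U')\<^sup>*}"
    define P where "P = (P' - Z) \<union> {a1, a2}"
    have anti: "(avoiding R U)\<^sup>* \<subseteq> (avoiding R U')\<^sup>*" "(avoiding R U)\<^sup>* \<subseteq> ?A\<^sup>*"
      using U by (auto intro!: rtrancl_avoiding_antimono)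
    have "p = q" if "p \<in> Z" "q \<in> Z" for p q
      using that P'(5)[of p q] rtrancl_symD[OF symA(3)] unfolding Z_def
      by (metis (no_types, lifting) mem_Collect_eq rtrancl_trans)
    then have "card Z \<le> 1" using P'(1) by (metis card_le_Suc0_iff_eq One_nat_def Z_def finite_Collect_conjI Collect_mem_eq)
    then have cardZ: "card (P' - Z) \<ge> card P' - 1"
      using diff_card_le_card_Diff[of Z P'] P'(1) by (simp add: Z_def)
    have a1n: "a' \<notin> P' - Z" if "a' = a1 \<or> a' = a2" for a'
      using to_x0 a12 that by (auto simp: Z_def)
    have "a1 \<noteq> a2" using a12 by auto
    then have "card P = card (P' - Z) + 2"
      unfolding P_def using a1n P'(1) by (subst card_Un_disjoint) auto
    moreover have "card T = card T' + 1"
      unfolding T'_def using card_Suc_Diff1[OF psubset.hyps t] by simp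
    ultimately have cardP: "card T \<le> card P" using cardZ P'(3) by linarith
    have "a' \<in> \<Lambda>" if "infinite_branch_at R (B t) a'" for a'
      using psubset.prems(3)[OF t] that by (auto simp: infinite_branch_at_def)
    then have PL: "P \<subseteq> \<Lambda>" using P'(2) a12 by (auto simp: P_def)
    have keep: "(p, z) \<in> (avoiding R U)\<^sup>*" if p: "p \<in> P' - Z" and z: "(p, z) \<in> (avoiding R U')\<^sup>*" for p z
    proof -
      have "w \<notin> B t" if "(p, w) \<in> (avoiding R U')\<^sup>*" for w
        using connected_within_avoiding[OF conn[OF t] disU _ x0] that p
        by (auto simp: Z_def intro: rtrancl_trans)
      then show ?thesis using z
        by - (erule rtrancl_restrict, auto simp: avoiding_def U)
    qed
    have inf1: "infinite ((avoiding R U)\<^sup>* `` {p})" if "p \<in> P' - Z" for p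
    proof -
      have "(avoiding R U')\<^sup>* `` {p} \<subseteq> (avoiding R U)\<^sup>* `` {p}" using keep[OF that] by auto
      then show ?thesis using P'(4) that finite_subset by blast
    qed
    have inf2: "infinite ((avoiding R U)\<^sup>* `` {a'})"
      if a': "infinite_branch_at R (B t) a'" "(d, a') \<notin> ?A\<^sup>*" for a'
    proof -
      have "?A\<^sup>* `` {a'} \<subseteq> (avoiding R U)\<^sup>* `` {a'}" using stay[OF a'] by auto
      then show ?thesis using a'(1) finite_subset unfolding infinite_branch_at_def by blast
    qed
    have sep: "(p, a') \<notin> (avoiding R U)\<^sup>*"
      if "p \<in> P' - Z" and a': "infinite_branch_at R (B t) a'" "(d, a') \<notin> ?A\<^sup>*" for p a'
      using to_x0[OF a'] that(1) anti(1) unfolding Z_def by (blast intro: rtrancl_trans)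
    have sep12: "(a1, a2) \<notin> (avoiding R U)\<^sup>*" using a12 anti by blast
    have "(p, q) \<notin> (avoiding R U)\<^sup>*" if pq: "p \<in> P" "q \<in> P" "p \<noteq> q" for p q
    proof -
      have "p \<in> P' - Z \<Longrightarrow> q \<in> P' - Z \<Longrightarrow> ?thesis" using P'(5) pq anti by blast
      moreover have "p \<in> P' - Z \<Longrightarrow> q = a1 \<or> q = a2 \<Longrightarrow> ?thesis" using sep a12 by blast
      moreover have "q \<in> P' - Z \<Longrightarrow> p = a1 \<or> p = a2 \<Longrightarrow> ?thesis"
        using sep a12 rtrancl_symD[OF symA(2)] by blast
      moreover have "p = a1 \<or> p = a2 \<Longrightarrow> q = a1 \<or> q = a2 \<Longrightarrow> ?thesis"
        using sep12 rtrancl_symD[OF symA(2)] pq by blast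
      ultimately show ?thesis using pq unfolding P_def by blast
    qed
    moreover have "infinite ((avoiding R U)\<^sup>* `` {p})" if "p \<in> P" for p
      using that inf1 inf2 a12 unfolding P_def by blast
    moreover have "finite P" using P'(1) by (simp add: P_def)
    ultimately show ?thesis using PL cardP unfolding U_def by blast
  qed
qed

text \<open>The representatives lie in the finite set \<Lambda>, but their infinite components do
  not fit into it. Each component contains a vertex with an edge leaving \<Lambda>, and different
  components give different vertices.\<close>

lemma card_trifurcations_le:
  fixes B :: "'t \<Rightarrow> 'a set"
  assumes R: "sym R" and T: "finite T" and L: "finite \<Lambda>"
    and disj: "\<And>s t. s \<in> T \<Longrightarrow> t \<in> T \<Longrightarrow> s \<noteq> t \<Longrightarrow> B s \<inter> B t = {}"
    and tri: "\<And>t. t \<in> T \<Longrightarrow> trifurcation R (B t)"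
    and nbr: "\<And>t. t \<in> T \<Longrightarrow> R `` B t \<subseteq> \<Lambda>"
  shows "card T \<le> card {z \<in> \<Lambda>. \<exists>w. w \<notin> \<Lambda> \<and> (z, w) \<in> R}"
proof -
  let ?A = "avoiding R (\<Union>(B ` T))"
  let ?bd = "{z \<in> \<Lambda>. \<exists>w. w \<notin> \<Lambda> \<and> (z, w) \<in> R}"
  obtain P where P: "finite P" "P \<subseteq> \<Lambda>" "card T \<le> card P"
    "\<And>p. p \<in> P \<Longrightarrow> infinite (?A\<^sup>* `` {p})"
    "\<And>p q. p \<in> P \<Longrightarrow> q \<in> P \<Longrightarrow> p \<noteq> q \<Longrightarrow> (p, q) \<notin> ?A\<^sup>*"
    using trifurcations_separate[where B = B and \<Lambda> = \<Lambda>, OF R T disj tri nbr] by auto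
  have "\<exists>z. z \<in> ?bd \<and> (p, z) \<in> ?A\<^sup>*" if p: "p \<in> P" for p
  proof -
    have "\<not> ?A\<^sup>* `` {p} \<subseteq> \<Lambda>" using P(4)[OF p] L finite_subset by blast
    then obtain y where y: "(p, y) \<in> ?A\<^sup>*" "y \<notin> \<Lambda>" by blast
    have "p \<in> \<Lambda>" using p P(2) by blast
    then obtain b a where ba: "b \<in> \<Lambda>" "a \<notin> \<Lambda>" "(b, a) \<in> ?A" "(p, b) \<in> ?A\<^sup>*"
      by (rule last_exit[OF y(1) _ y(2)])
    have "(b, a) \<in> R" using ba(3) by (simp add: avoiding_def)
    then show ?thesis using ba by (intro exI[of _ b]) auto
  qed
  then have "\<exists>f. \<forall>p\<in>P. f p \<in> ?bd \<and> (p, f p) \<in> ?A\<^sup>*" by (intro bchoice) blast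
  then obtain f where f: "\<And>p. p \<in> P \<Longrightarrow> f p \<in> ?bd" "\<And>p. p \<in> P \<Longrightarrow> (p, f p) \<in> ?A\<^sup>*" by blast
  have "inj_on f P"
  proof (rule inj_onI)
    fix p q assume pq: "p \<in> P" "q \<in> P" "f p = f q"
    have "(f q, q) \<in> ?A\<^sup>*" using f(2)[OF pq(2)] rtrancl_symD[OF sym_avoiding[OF R]] by blast
    then show "p = q" using f(2)[OF pq(1)] P(5) pq by (metis rtrancl_trans)
  qed
  then have "card P \<le> card ?bd" using f(1) L by (intro card_inj_on_le[of f]) auto
  then show ?thesis using P(3) by linarith
qed

section \<open>Connecting a box by flipping faces\<close>

type_synonym edge_config = "bool \<times> int \<times> int \<Rightarrow> bool"

text \<open>A configuration of the edges of the square lattice: (True, i, j) is the edge from (i, j) to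
  (i + 1, j), and (False, i, j) the one from (i, j) to (i, j + 1). Faces are named after their
  lower-left corner.\<close>

definition grid_rel :: "edge_config \<Rightarrow> (int \<times> int) rel" where
  "grid_rel c = {((i, j), (i', j')).
     (j' = j \<and> (i' = i + 1 \<and> c (True, i, j) \<or> i = i' + 1 \<and> c (True, i', j))) \<or>
     (i' = i \<and> (j' = j + 1 \<and> c (False, i, j) \<or> j = j' + 1 \<and> c (False, i, j')))}"

text \<open>The two sides are the parities of the numbers of horizontal and of vertical edges at
  \<open>(i, j)\<close>; their agreement means even degree.\<close>

definition even_config :: "edge_config \<Rightarrow> bool" where
  "even_config c \<longleftrightarrow> (\<forall>i j. (c (True, i, j) \<noteq> c (True, i - 1, j)) = (c (False, i, j) \<noteq> c (False, i, j - 1)))"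

text \<open>An edge changes when exactly one of the two faces beside it lies in \<open>D\<close>,
  which is the effect of recolouring \<open>D\<close> on the domain walls. The face
  \<open>(i, j)\<close> lies above the horizontal edge at \<open>(i, j)\<close> and to the right of
  the vertical one.\<close>

definition flips :: "(int \<times> int) set \<Rightarrow> edge_config \<Rightarrow> edge_config" where
  "flips D c = (\<lambda>(d, i, j). c (d, i, j) \<noteq>
     (((i, j) \<in> D) \<noteq> ((if d then (i, j - 1) else (i - 1, j)) \<in> D)))"

definition box :: "int \<Rightarrow> (int \<times> int) set" where
  "box K = {-K..K} \<times> {-K..K}"

text \<open>Half-open, as a face is named after its lower-left corner: these are the faces with all
  four corners in \<open>box K\<close>, so flipping them changes only edges with both ends in the
  box.\<close>

definition box_faces :: "int \<Rightarrow> (int \<times> int) set" where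
  "box_faces K = {-K..<K} \<times> {-K..<K}"

lemma finite_box: "finite (box K)"
  by (simp add: box_def)

lemma finite_box_faces: "finite (box_faces K)"
  by (simp add: box_faces_def)

lemma exists_box:
  assumes "finite X"
  obtains K where "K \<ge> 2" "X \<subseteq> box K"
proof -
  define K where "K = 2 + (\<Sum>x\<in>X. \<bar>fst x\<bar> + \<bar>snd x\<bar>)"
  have "x \<in> box K" if "x \<in> X" for x
  proof -
    have "\<bar>fst x\<bar> + \<bar>snd x\<bar> \<le> (\<Sum>x\<in>X. \<bar>fst x\<bar> + \<bar>snd x\<bar>)"
      using assms that by (intro member_le_sum) auto
    then show ?thesis by (auto simp: box_def K_def mem_Times_iff)
  qed
  moreover have "K \<ge> 2" by (auto simp: K_def intro!: sum_nonneg)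
  ultimately show thesis using that by blast
qed

lemma sym_grid_rel: "sym (grid_rel c)"
  by (auto simp: sym_def grid_rel_def)

lemma grid_rel_neighbours:
  assumes "(x, y) \<in> grid_rel c"
  shows "fst y \<in> {fst x - 1..fst x + 1}" "snd y \<in> {snd x - 1..snd x + 1}"
  using assms by (auto simp: grid_rel_def)

lemma finite_grid_rel_Image: "finite (grid_rel c `` {x})"
proof -
  have "grid_rel c `` {x} \<subseteq> {fst x - 1..fst x + 1} \<times> {snd x - 1..snd x + 1}"
    using grid_rel_neighbours by (fastforce simp: mem_Times_iff)
  then show ?thesis using finite_subset by blast
qed

lemma flips_flips: "flips D (flips D c) = c"
  by (auto simp: flips_def fun_eq_iff)

lemma flips_empty: "flips {} c = c"
  by (auto simp: flips_def fun_eq_iff)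

lemma flips_insert: "S \<notin> D \<Longrightarrow> flips (insert S D) c = flips {S} (flips D c)"
  by (auto simp: flips_def fun_eq_iff)

lemma grid_rel_flips_outside:
  assumes "D \<subseteq> box_faces K" "x \<notin> box K \<or> y \<notin> box K"
  shows "(x, y) \<in> grid_rel (flips D c) \<longleftrightarrow> (x, y) \<in> grid_rel c"
proof -
  obtain i j i' j' where xy: "x = (i, j)" "y = (i', j')" by (cases x; cases y)
  have nD: "(a, b) \<notin> D" if "\<not> (-K \<le> a \<and> a < K \<and> -K \<le> b \<and> b < K)" for a b
    using that assms(1) by (auto simp: box_faces_def)
  have H: "flips D c (True, a, b) = c (True, a, b)"
    if "(a, b) \<notin> box K \<or> (a + 1, b) \<notin> box K" for a b
    using that by (auto simp: flips_def box_def nD)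
  have V: "flips D c (False, a, b) = c (False, a, b)"
    if "(a, b) \<notin> box K \<or> (a, b + 1) \<notin> box K" for a b
    using that by (auto simp: flips_def box_def nD)
  show ?thesis using assms(2) H V by (auto simp: grid_rel_def xy)
qed

lemma avoiding_box_flips:
  assumes "D \<subseteq> box_faces K"
  shows "avoiding (grid_rel (flips D c)) (box K) = avoiding (grid_rel c) (box K)"
  using grid_rel_flips_outside[OF assms] by (auto simp: avoiding_def)

section \<open>Even configurations as domain walls of face colourings\<close>

lemma prefix_parity:
  fixes a :: "int \<Rightarrow> bool"
  shows "\<exists>f. \<forall>n\<ge>m. f (n + 1) = (f n \<noteq> a n)"
proof (intro exI[of _ "\<lambda>n. odd (card {k \<in> {m..<n}. a k})"] allI impI)
  fix n :: int assume n: "n \<ge> m"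
  have I: "{m..<n + 1} = insert n {m..<n}" using n by auto
  have fin: "finite {k \<in> {m..<n}. a k}" by (rule finite_subset[of _ "{m..<n}"]) auto
  show "odd (card {k \<in> {m..<n + 1}. a k}) = (odd (card {k \<in> {m..<n}. a k}) \<noteq> a n)"
  proof (cases "a n")
    case True
    then have "{k \<in> {m..<n + 1}. a k} = insert n {k \<in> {m..<n}. a k}" unfolding I by auto
    then show ?thesis using True fin by (simp only: card_insert_disjoint[OF fin]) simp
  next
    case False
    then have "{k \<in> {m..<n + 1}. a k} = {k \<in> {m..<n}. a k}" unfolding I by auto
    then show ?thesis using False by simp
  qed
qed

text \<open>\<open>f\<close> sums the vertical edges along row \<open>m\<close> modulo 2, and
  \<open>g i\<close> the horizontal edges up column \<open>i\<close>; even degrees make the result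
  consistent in the other columns, by induction on \<open>j\<close>. A quadrant with corner
  \<open>(m, m)\<close> suffices because only a bounded region will be recoloured, so the sums run
  in one direction only.\<close>

lemma face_colouring:
  assumes "even_config c"
  obtains \<sigma> :: "int \<Rightarrow> int \<Rightarrow> bool" where
    "\<And>i j. i \<ge> m \<Longrightarrow> j > m \<Longrightarrow> c (True, i, j) = (\<sigma> i j \<noteq> \<sigma> i (j - 1))"
    "\<And>i j. i > m \<Longrightarrow> j \<ge> m \<Longrightarrow> c (False, i, j) = (\<sigma> i j \<noteq> \<sigma> (i - 1) j)"
proof -
  obtain f where f: "\<And>i. i \<ge> m \<Longrightarrow> f (i + 1) = (f i \<noteq> c (False, i + 1, m))"
    using prefix_parity[of m "\<lambda>i. c (False, i + 1, m)"] by auto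
  have "\<forall>i. \<exists>g. \<forall>j\<ge>m. g (j + 1) = (g j \<noteq> c (True, i, j + 1))"
    by (intro allI prefix_parity)
  from choice[OF this] obtain g where
    g: "\<And>i j. j \<ge> m \<Longrightarrow> g i (j + 1) = (g i j \<noteq> c (True, i, j + 1))" by auto
  \<comment> \<open>Each column is shifted so that \<open>\<sigma> i m = f i\<close>.\<close>
  define \<sigma> where "\<sigma> i j = (g i j \<noteq> (g i m \<noteq> f i))" for i j
  have H: "c (True, i, j) = (\<sigma> i j \<noteq> \<sigma> i (j - 1))" if "j > m" for i j
    using g[of "j - 1" i] that by (auto simp: \<sigma>_def)
  have V: "c (False, i, j) = (\<sigma> i j \<noteq> \<sigma> (i - 1) j)" if i: "i > m" and "j \<ge> m" for i j
    using \<open>j \<ge> m\<close>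
  proof (induction j rule: int_ge_induct)
    case base
    then show ?case using f[of "i - 1"] i by (auto simp: \<sigma>_def)
  next
    case (step j)
    have "(c (True, i, j + 1) \<noteq> c (True, i - 1, j + 1)) = (c (False, i, j + 1) \<noteq> c (False, i, j))"
      using assms[unfolded even_config_def, rule_format, of i "j + 1"] by simp
    then show ?case using step H[of "j + 1" i] H[of "j + 1" "i - 1"] by auto
  qed
  show thesis using that H V by blast
qed

text \<open>The column of faces x lo, \<dots>, x (hi - 1) lies between the columns y and r, and
  x (lo - 1) and x hi are the faces at its ends. Wu and Wv say which vertices on the side of y and
  on the side of r are connected to the part already treated.\<close>

definition joins_column :: "int \<Rightarrow> int \<Rightarrow> (int \<Rightarrow> bool) \<Rightarrow> (int \<Rightarrow> bool) \<Rightarrow> (int \<Rightarrow> bool) \<Rightarrow> bool" where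
  "joins_column lo hi y r x \<longleftrightarrow>
    (\<forall>Wu Wv. (\<forall>j. lo < j \<and> j < hi \<longrightarrow> Wu j) \<longrightarrow>
     (\<forall>j. lo \<le> j \<and> j < hi \<and> x j \<noteq> r j \<longrightarrow> Wv j = Wv (j + 1)) \<longrightarrow>
     (\<forall>j. lo \<le> j \<and> j < hi \<and> x j \<noteq> y j \<longrightarrow> Wu j = Wu (j + 1)) \<longrightarrow>
     (\<forall>j. lo \<le> j \<and> j \<le> hi \<and> x j \<noteq> x (j - 1) \<longrightarrow> Wu j = Wv j) \<longrightarrow>
     (\<forall>j. lo \<le> j \<and> j \<le> hi \<longrightarrow> Wu j \<and> Wv j))"

text \<open>Taking x different from r joins the outer vertices. An end face is changed if this isolates the
  adjacent corner on the side of y, and if x is then constant, one more change makes two horizontal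
  edges appear.\<close>

lemma column_filling:
  fixes y r :: "int \<Rightarrow> bool" and lo hi :: int
  assumes "lo + 3 \<le> hi"
  shows "\<exists>x. x (lo - 1) = p \<and> x hi = q \<and> joins_column lo hi y r x"
proof -
  define z where "z j = (if j < lo then p else if j \<ge> hi then q
     else if j = lo \<and> p = y lo then \<not> p
     else if j = hi - 1 \<and> q = y (hi - 1) then \<not> q else \<not> r j)" for j
  define flat where "flat \<longleftrightarrow> (\<forall>j. lo \<le> j \<and> j < hi \<longrightarrow> z j = z lo)"
  \<comment> \<open>In the flat case the face \<open>lo + 1\<close> loses its edge towards
    \<open>r\<close>, but that edge would only join the vertices \<open>lo + 1\<close> and
    \<open>lo + 2\<close> on that side, and both are now reached by horizontal edges. With three
    faces in the column, \<open>lo + 1\<close> is not an end face.\<close>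
  define x where "x = (if flat then z(lo + 1 := \<not> z (lo + 1)) else z)"
  have ends: "x (lo - 1) = p" "x hi = q" using assms by (auto simp: x_def z_def)
  have W: "Wu j \<and> Wv j"
    if U: "\<And>j. lo < j \<Longrightarrow> j < hi \<Longrightarrow> Wu j"
      and R: "\<And>j. lo \<le> j \<Longrightarrow> j < hi \<Longrightarrow> x j \<noteq> r j \<Longrightarrow> Wv j = Wv (j + 1)"
      and L: "\<And>j. lo \<le> j \<Longrightarrow> j < hi \<Longrightarrow> x j \<noteq> y j \<Longrightarrow> Wu j = Wu (j + 1)"
      and H: "\<And>j. lo \<le> j \<Longrightarrow> j \<le> hi \<Longrightarrow> x j \<noteq> x (j - 1) \<Longrightarrow> Wu j = Wv j"
      and j: "lo \<le> j" "j \<le> hi" for Wu Wv j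
  proof -
    have xlo: "x lo = z lo" and xhi: "x (hi - 1) = z (hi - 1)" using assms by (auto simp: x_def)
    have mid: "Wv i = Wv (i + 1)" if "lo < i" "i < hi - 1" "\<not> flat \<or> i \<noteq> lo + 1" for i
    proof (rule R)
      have "x i = z i" "z i = (\<not> r i)" using that by (auto simp: x_def z_def)
      then show "x i \<noteq> r i" by simp
    qed (use that in auto)
    have right: "Wv i = Wv s" if "i \<ge> s" "i < hi" "lo < s" "\<not> flat \<or> s \<ge> lo + 2" for i s
      using that(1,2)
    proof (induction i rule: int_ge_induct)
      case (step i)
      have "Wv (i + 1) = Wv i" using mid[of i] step.hyps step.prems that(3,4) by auto
      also have "\<dots> = Wv s" using step by simp
      finally show ?case .
    qed simp
    have Vmid: "Wv i" if i: "lo < i" "i < hi" for i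
    proof (cases flat)
      case True
      have F: "z j = z lo" if "lo \<le> j" "j < hi" for j using True that unfolding flat_def by blast
      have z12: "z (lo + 1) = z lo" "z (lo + 2) = z lo" using assms by (auto intro!: F)
      have "x (lo + 1) \<noteq> x lo" using True z12(1) by (simp add: x_def)
      then have 1: "Wv (lo + 1)" using H[of "lo + 1"] U[of "lo + 1"] assms by simp
      have "x (lo + 2) \<noteq> x (lo + 1)" using True z12 by (simp add: x_def)
      then have 2: "Wv (lo + 2)" using H[of "lo + 2"] U[of "lo + 2"] assms by (simp add: algebra_simps)
      show ?thesis using 1 2 right[of "lo + 2" i] i by (cases "i = lo + 1") auto
    next
      case False
      \<comment> \<open>A change of colour inside the column is a horizontal edge from the side of
        \<open>y\<close>; from its other end the vertical edges next to \<open>r\<close> reach all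
        inner vertices.\<close>
      have "\<exists>s. lo < s \<and> s < hi \<and> z s \<noteq> z (s - 1)"
      proof (rule ccontr)
        assume no: "\<not> (\<exists>s. lo < s \<and> s < hi \<and> z s \<noteq> z (s - 1))"
        have "i < hi \<longrightarrow> z i = z lo" if "lo \<le> i" for i
          using that
        proof (induction i rule: int_ge_induct)
          case (step i)
          have "\<not> (lo < i + 1 \<and> i + 1 < hi \<and> z (i + 1) \<noteq> z (i + 1 - 1))" using no by blast
          then show ?case using step by auto
        qed simp
        then show False using False unfolding flat_def by blast
      qed
      then obtain s where s: "lo < s" "s < hi" "z s \<noteq> z (s - 1)" by blast
      then have "Wv s" using H[of s] U[of s] False by (simp add: x_def)
      then show ?thesis using right[of "lo + 1" i] right[of "lo + 1" s] s i False by auto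
    qed
    have lo: "Wu lo \<and> Wv lo"
    proof -
      have a: "z lo \<noteq> p \<Longrightarrow> Wu lo = Wv lo" using H[of lo] ends xlo assms by simp
      have b: "z lo \<noteq> r lo \<Longrightarrow> Wv lo" using R[of lo] xlo assms Vmid[of "lo + 1"] by simp
      have c: "z lo \<noteq> y lo \<Longrightarrow> Wu lo" using L[of lo] xlo assms U[of "lo + 1"] by simp
      \<comment> \<open>If \<open>p = y lo\<close>, the corner on the side of \<open>y\<close> gets
        both its edges, one of which leads to the other corner. Otherwise \<open>z lo\<close>
        differs from one of \<open>p\<close> and \<open>y lo\<close>, so this corner has an edge in
        any case, and the choice \<open>\<not> r lo\<close> serves the other corner.\<close>
      have "p = y lo \<Longrightarrow> z lo = (\<not> p)" "p \<noteq> y lo \<Longrightarrow> z lo = (\<not> r lo)" using assms by (auto simp: z_def)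
      then show ?thesis using a b c by metis
    qed
    have hi: "Wu hi \<and> Wv hi"
    proof -
      have a: "z (hi - 1) \<noteq> q \<Longrightarrow> Wu hi = Wv hi" using H[of hi] ends xhi assms by auto
      have b: "z (hi - 1) \<noteq> r (hi - 1) \<Longrightarrow> Wv hi" using R[of "hi - 1"] xhi assms Vmid[of "hi - 1"] by simp
      have c: "z (hi - 1) \<noteq> y (hi - 1) \<Longrightarrow> Wu hi" using L[of "hi - 1"] xhi assms U[of "hi - 1"] by simp
      have "q = y (hi - 1) \<Longrightarrow> z (hi - 1) = (\<not> q)" "q \<noteq> y (hi - 1) \<Longrightarrow> z (hi - 1) = (\<not> r (hi - 1))"
        using assms by (auto simp: z_def)
      then show ?thesis using a b c by metis
    qed
    show ?thesis using U[of j] Vmid[of j] lo hi j by (cases "j = lo"; cases "j = hi") auto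
  qed
  have "joins_column lo hi y r x"
    unfolding joins_column_def by (intro allI impI, rule W) blast+
  then show ?thesis using ends by blast
qed

text \<open>The interior columns of the box get a checkerboard colouring, so that all edges between them
  are present; the two outer columns absorb the boundary conditions.\<close>

lemma connecting_flips:
  assumes c: "even_config c" and K: "K \<ge> 2"
  obtains D where "D \<subseteq> box_faces K" "connected_within (grid_rel (flips D c)) (box K)"
proof -
  \<comment> \<open>Starting at \<open>-K - 1\<close> includes the ring of faces around the box,
    whose colours matter for the edges on its rim.\<close>
  obtain \<sigma> :: "int \<Rightarrow> int \<Rightarrow> bool" where \<sigma>:
    "\<And>i j. i \<ge> -K - 1 \<Longrightarrow> j > -K - 1 \<Longrightarrow> c (True, i, j) = (\<sigma> i j \<noteq> \<sigma> i (j - 1))"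
    "\<And>i j. i > -K - 1 \<Longrightarrow> j \<ge> -K - 1 \<Longrightarrow> c (False, i, j) = (\<sigma> i j \<noteq> \<sigma> (i - 1) j)"
    using face_colouring[OF c, of "-K - 1"] by blast
  have len: "-K + 3 \<le> K" using K by simp
  obtain l where l: "l (-K - 1) = \<sigma> (-K) (-K - 1)" "l K = \<sigma> (-K) K"
    and l_joins: "joins_column (-K) K (\<lambda>j. even (-K + 1 + j)) (\<sigma> (-K - 1)) l"
    using column_filling[OF len] by metis
  obtain r where r: "r (-K - 1) = \<sigma> (K - 1) (-K - 1)" "r K = \<sigma> (K - 1) K"
    and r_joins: "joins_column (-K) K (\<lambda>j. even (K - 2 + j)) (\<sigma> K) r"
    using column_filling[OF len] by metis
  define \<tau> where "\<tau> i j = (if (i, j) \<in> box_faces K then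
      (if i = -K then l j else if i = K - 1 then r j else even (i + j)) else \<sigma> i j)" for i j
  define D where "D = {(i, j) \<in> box_faces K. \<tau> i j \<noteq> \<sigma> i j}"
  have DK: "D \<subseteq> box_faces K" by (auto simp: D_def)
  have mem: "(i, j) \<in> D \<longleftrightarrow> \<tau> i j \<noteq> \<sigma> i j" for i j by (auto simp: D_def \<tau>_def)
  define R where "R = grid_rel (flips D c) \<inter> box K \<times> box K"
  define W where "W i j \<longleftrightarrow> ((0, 0), (i, j)) \<in> R\<^sup>*" for i j
  have symR: "sym R" using sym_grid_rel by (auto simp: R_def sym_def)
  have adj: "W i j = W i' j'" if "((i, j), (i', j')) \<in> R" for i j i' j'
    using that symR unfolding W_def by (meson rtrancl.rtrancl_into_rtrancl symD)
  have H: "W i j = W (i + 1) j" if "\<tau> i j \<noteq> \<tau> i (j - 1)" "-K \<le> i" "i < K" "-K \<le> j" "j \<le> K" for i j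
  proof (rule adj)
    have "flips D c (True, i, j)" using that \<sigma>(1)[of i j] by (auto simp: flips_def mem)
    then show "((i, j), (i + 1, j)) \<in> R" using that by (auto simp: R_def grid_rel_def box_def)
  qed
  have V: "W i j = W i (j + 1)" if "\<tau> i j \<noteq> \<tau> (i - 1) j" "-K \<le> i" "i \<le> K" "-K \<le> j" "j < K" for i j
  proof (rule adj)
    have "flips D c (False, i, j)" using that \<sigma>(2)[of i j] by (auto simp: flips_def mem)
    then show "((i, j), (i, j + 1)) \<in> R" using that by (auto simp: R_def grid_rel_def box_def)
  qed
  have \<tau>mid: "\<tau> i j = even (i + j)" if "-K < i" "i < K - 1" "-K \<le> j" "j < K" for i j
    using that by (auto simp: \<tau>_def box_faces_def)
  have \<tau>l: "\<tau> (-K) j = l j" if "-K - 1 \<le> j" "j \<le> K" for j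
    using that l K by (cases "j = -K - 1"; cases "j = K") (auto simp: \<tau>_def box_faces_def)
  have \<tau>r: "\<tau> (K - 1) j = r j" if "-K - 1 \<le> j" "j \<le> K" for j
    using that r K by (cases "j = -K - 1"; cases "j = K") (auto simp: \<tau>_def box_faces_def)
  have \<tau>out: "\<tau> (-K - 1) j = \<sigma> (-K - 1) j" "\<tau> K j = \<sigma> K j" for j
    by (auto simp: \<tau>_def box_faces_def)
  have W00: "W 0 0" by (simp add: W_def)
  \<comment> \<open>The vertices with first coordinate \<open>i\<close> lie between the face columns
    \<open>i - 1\<close> and \<open>i\<close>, here both in the checkerboard.
    \<open>K \<ge> 2\<close> makes \<open>i = 0\<close> admissible, and from this line all inner
    vertices are reached horizontally.\<close>
  have vert: "W i j = W i (j + 1)" if "-K + 1 < i" "i < K - 1" "-K \<le> j" "j < K" for i j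
    using that by (intro V) (auto simp: \<tau>mid)
  have hor: "W i j = W (i + 1) j" if "-K < i" "i < K - 1" "-K < j" "j < K" for i j
    using that by (intro H) (auto simp: \<tau>mid)
  have W0up: "j < K \<longrightarrow> W 0 j" if "0 \<le> j" for j
    using that
  proof (induction j rule: int_ge_induct)
    case (step j)
    then show ?case using vert[of 0 j] K by auto
  qed (use W00 in simp)
  have W0down: "-K < j \<longrightarrow> W 0 j" if "j \<le> 0" for j
    using that
  proof (induction j rule: int_le_induct)
    case (step j)
    then show ?case using vert[of 0 "j - 1"] K by auto
  qed (use W00 in simp)
  have W0: "W 0 j" if "-K < j" "j < K" for j using that W0up W0down by (cases "0 \<le> j") auto
  have Wright: "i < K \<longrightarrow> W i j" if "0 \<le> i" and j: "-K < j" "j < K" for i j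
    using that(1)
  proof (induction i rule: int_ge_induct)
    case (step i)
    then show ?case using hor[of i j] j K by auto
  qed (use W0 j in simp)
  have Wleft: "-K < i \<longrightarrow> W i j" if "i \<le> 0" and j: "-K < j" "j < K" for i j
    using that(1)
  proof (induction i rule: int_le_induct)
    case (step i)
    then show ?case using hor[of "i - 1" j] j K by auto
  qed (use W0 j in simp)
  have Wmid: "W i j" if "-K < i" "i < K" "-K < j" "j < K" for i j
    using that Wright Wleft by (cases "0 \<le> i") auto
  have Winner: "W i j" if "-K + 1 < i" "i < K - 1" "-K \<le> j" "j \<le> K" for i j
    using that Wmid[of i j] vert[of i "-K"] Wmid[of i "-K + 1"] vert[of i "K - 1"] Wmid[of i "K - 1"] K
    by (cases "j = -K"; cases "j = K") auto
  \<comment> \<open>Only the inner vertices at \<open>-K + 1\<close> are known to be connected so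
    far; the filled column brings in the two ends and the rim.\<close>
  have left: "W (-K + 1) j \<and> W (-K) j" if "-K \<le> j" "j \<le> K" for j
  proof (rule l_joins[unfolded joins_column_def, rule_format, where Wu = "W (-K + 1)" and Wv = "W (-K)", OF _ _ _ _ conjI[OF that]])
    show "W (-K + 1) j" if "-K < j \<and> j < K" for j using that Wmid K by simp
    show "W (-K) j = W (-K) (j + 1)" if "-K \<le> j \<and> j < K \<and> l j \<noteq> \<sigma> (-K - 1) j" for j
      using that V[of "-K" j] K by (simp add: \<tau>l \<tau>out)
    show "W (-K + 1) j = W (-K + 1) (j + 1)" if "-K \<le> j \<and> j < K \<and> l j \<noteq> even (-K + 1 + j)" for j
      using that K by (intro V) (auto simp: \<tau>l \<tau>mid)
    show "W (-K + 1) j = W (-K) j" if "-K \<le> j \<and> j \<le> K \<and> l j \<noteq> l (j - 1)" for j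
      using that H[of "-K" j] K by (simp add: \<tau>l)
  qed
  have right: "W (K - 1) j \<and> W K j" if "-K \<le> j" "j \<le> K" for j
  proof (rule r_joins[unfolded joins_column_def, rule_format, where Wu = "W (K - 1)" and Wv = "W K", OF _ _ _ _ conjI[OF that]])
    show "W (K - 1) j" if "-K < j \<and> j < K" for j using that Wmid K by simp
    show "W K j = W K (j + 1)" if "-K \<le> j \<and> j < K \<and> r j \<noteq> \<sigma> K j" for j
      using that V[of K j] K by (auto simp: \<tau>r \<tau>out)
    show "W (K - 1) j = W (K - 1) (j + 1)" if "-K \<le> j \<and> j < K \<and> r j \<noteq> even (K - 2 + j)" for j
      using that K by (intro V) (auto simp: \<tau>r \<tau>mid)
    show "W (K - 1) j = W K j" if "-K \<le> j \<and> j \<le> K \<and> r j \<noteq> r (j - 1)" for j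
      using that H[of "K - 1" j] K by (auto simp: \<tau>r)
  qed
  have all: "W i j" if "(i, j) \<in> box K" for i j
  proof -
    have ij: "-K \<le> i" "i \<le> K" "-K \<le> j" "j \<le> K" using that by (auto simp: box_def)
    consider "i = -K" | "i = -K + 1" | "-K + 1 < i \<and> i < K - 1" | "i = K - 1" | "i = K"
      using ij by linarith
    then show ?thesis using left[of j] right[of j] Winner[of i j] ij by cases auto
  qed
  have "(x, y) \<in> R\<^sup>*" if "x \<in> box K" "y \<in> box K" for x y
  proof -
    have "((0, 0), x) \<in> R\<^sup>*" "((0, 0), y) \<in> R\<^sup>*"
      using all[of "fst x" "snd x"] all[of "fst y" "snd y"] that by (auto simp: W_def)
    then show ?thesis using rtrancl_symD[OF symR] by (meson rtrancl_trans)
  qed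
  then have "connected_within (grid_rel (flips D c)) (box K)" by (simp add: connected_within_def R_def)
  then show thesis using that DK by blast
qed

section \<open>Infinite clusters of the square lattice\<close>

lemma rtrancl_inv_image:
  assumes "surj f" "inj f"
  shows "(x, y) \<in> (inv_image R f)\<^sup>* \<longleftrightarrow> (f x, f y) \<in> R\<^sup>*"
proof -
  have "(f x, f y) \<in> R\<^sup>*" if "(x, y) \<in> (inv_image R f)\<^sup>*"
    using that by (induction rule: rtrancl_induct) (auto intro: rtrancl_into_rtrancl)
  moreover have "\<forall>y. v = f y \<longrightarrow> (x, y) \<in> (inv_image R f)\<^sup>*" if "(f x, v) \<in> R\<^sup>*" for v
    using that
  proof (induction rule: rtrancl_induct)
    case base
    then show ?case using \<open>inj f\<close> by (auto simp: inj_eq)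
  next
    case (step v w)
    obtain z where z: "v = f z" using \<open>surj f\<close> by (meson surjD)
    show ?case
    proof (intro allI impI)
      fix y assume "w = f y"
      then have "(z, y) \<in> inv_image R f" using step z by auto
      moreover have "(x, z) \<in> (inv_image R f)\<^sup>*" using step z by blast
      ultimately show "(x, y) \<in> (inv_image R f)\<^sup>*" by (rule rtrancl_into_rtrancl[rotated])
    qed
  qed
  ultimately show ?thesis by blast
qed

definition infinite_cluster :: "'a rel \<Rightarrow> 'a \<Rightarrow> bool" where
  "infinite_cluster R x \<longleftrightarrow> infinite (R\<^sup>* `` {x})"

definition two_infinite_clusters :: "'a rel \<Rightarrow> bool" where
  "two_infinite_clusters R \<longleftrightarrow>
     (\<exists>x y. infinite_cluster R x \<and> infinite_cluster R y \<and> (x, y) \<notin> R\<^sup>*)"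

definition separate_infinite_clusters :: "'a rel \<Rightarrow> 'a \<Rightarrow> 'a \<Rightarrow> 'a \<Rightarrow> bool" where
  "separate_infinite_clusters R x y z \<longleftrightarrow>
     infinite_cluster R x \<and> infinite_cluster R y \<and> infinite_cluster R z \<and>
     (x, y) \<notin> R\<^sup>* \<and> (x, z) \<notin> R\<^sup>* \<and> (y, z) \<notin> R\<^sup>*"

lemma infinite_cluster_inv_image:
  assumes "bij f"
  shows "infinite_cluster (inv_image R f) x \<longleftrightarrow> infinite_cluster R (f x)"
proof -
  have f: "surj f" "inj f" using assms by (simp_all add: bij_is_surj bij_is_inj)
  have "R\<^sup>* `` {f x} = f ` ((inv_image R f)\<^sup>* `` {x})"
  proof (intro set_eqI iffI)
    fix v assume v: "v \<in> R\<^sup>* `` {f x}"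
    obtain y where y: "v = f y" using surjD[OF f(1)] by blast
    then show "v \<in> f ` ((inv_image R f)\<^sup>* `` {x})" using v rtrancl_inv_image[OF f] by blast
  qed (use rtrancl_inv_image[OF f] in auto)
  then show ?thesis unfolding infinite_cluster_def
    using finite_image_iff[OF inj_on_subset[OF f(2)]] by simp
qed

lemma two_infinite_clusters_inv_image:
  assumes "bij f"
  shows "two_infinite_clusters (inv_image R f) \<longleftrightarrow> two_infinite_clusters R"
proof -
  have f: "surj f" "inj f" using assms by (simp_all add: bij_is_surj bij_is_inj)
  show ?thesis
    unfolding two_infinite_clusters_def infinite_cluster_inv_image[OF assms]
    using rtrancl_inv_image[OF f] f(1) by (metis surjD)
qed

lemma avoiding_inv_image:
  "inj f \<Longrightarrow> avoiding (inv_image R f) B = inv_image (avoiding R (f ` B)) f"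
  by (auto simp: avoiding_def inj_image_mem_iff)

lemma trifurcation_inv_image:
  assumes "bij f" "trifurcation (inv_image R f) B"
  shows "trifurcation R (f ` B)"
proof -
  have f: "surj f" "inj f" using assms by (simp_all add: bij_is_surj bij_is_inj)
  have "inv_image R f \<inter> B \<times> B = inv_image (R \<inter> f ` B \<times> f ` B) f"
    using f(2) by (auto simp: inj_image_mem_iff)
  then have "connected_within R (f ` B)"
    using assms(2) rtrancl_inv_image[OF f] by (auto simp: trifurcation_def connected_within_def)
  moreover have "infinite_branch_at R (f ` B) (f a)" if "infinite_branch_at (inv_image R f) B a" for a
    using that infinite_cluster_inv_image[OF assms(1), of "avoiding R (f ` B)" a] f(2)
    by (auto simp: infinite_branch_at_def infinite_cluster_def avoiding_inv_image inj_image_mem_iff)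
  ultimately show ?thesis
    using assms(2) rtrancl_inv_image[OF f]
    unfolding trifurcation_def avoiding_inv_image[OF f(2)] by blast
qed

section \<open>Translates of a box and their number in a square\<close>

definition translate :: "int \<Rightarrow> int \<Rightarrow> int \<times> int \<Rightarrow> int \<times> int" where
  "translate s t = (\<lambda>(i, j). (i + s, j + t))"

definition shift_config :: "int \<Rightarrow> int \<Rightarrow> edge_config \<Rightarrow> edge_config" where
  "shift_config s t c = (\<lambda>(d, i, j). c (d, i + s, j + t))"

lemma bij_translate: "bij (translate s t)"
  by (rule bij_betw_byWitness[where f' = "translate (- s) (- t)"]) (auto simp: translate_def)

lemma grid_rel_shift_config:
  "grid_rel (shift_config s t c) = inv_image (grid_rel c) (translate s t)"
proof -
  have "(i + s = i' + s + 1) = (i = i' + 1)" "(j + t = j' + t + 1) = (j = j' + 1)" for i i' j j' by auto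
  then show ?thesis by (auto simp: grid_rel_def shift_config_def translate_def inv_image_def)
qed

text \<open>The spacing \<open>M\<close> exceeds the width \<open>2 * K\<close> of a box, so the
  translates are disjoint. \<Lambda> reaches at least one unit beyond the boxes, so as to contain
  their neighbours; its side has \<open>n * M + 2 * K + 3\<close> vertices, and the bound adds up
  the four sides.\<close>

lemma card_trifurcation_boxes:
  assumes M: "M \<ge> 2 * K + 1" and K: "K \<ge> 0"
  shows "card {(i, j) \<in> {0..<int n} \<times> {0..<int n}. trifurcation (grid_rel c) (translate (M * i) (M * j) ` box K)}
     \<le> 4 * nat (int n * M + 2 * K + 3)"
proof -
  let ?R = "grid_rel c"
  define T where "T = {(i, j) \<in> {0..<int n} \<times> {0..<int n}. trifurcation ?R (translate (M * i) (M * j) ` box K)}"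
  define lo hi where "lo = -K - 1" and "hi = K + 1 + int n * M"
  define \<Lambda> where "\<Lambda> = {lo..hi} \<times> {lo..hi}"
  define F where "F = {lo, hi} \<times> {lo..hi} \<union> {lo..hi} \<times> {lo, hi}"
  define B where "B = (\<lambda>(i, j). translate (M * i) (M * j) ` box K)"
  have B: "x \<in> B (i, j) \<longleftrightarrow> fst x \<in> {M * i - K..M * i + K} \<and> snd x \<in> {M * j - K..M * j + K}" for x i j
  proof
    assume "fst x \<in> {M * i - K..M * i + K} \<and> snd x \<in> {M * j - K..M * j + K}"
    then show "x \<in> B (i, j)" unfolding B_def prod.case
      by (intro image_eqI[of _ _ "(fst x - M * i, snd x - M * j)"])
        (auto simp: translate_def box_def)
  qed (auto simp: B_def translate_def box_def)
  have apart: "i = i'" if "a \<in> {M * i - K..M * i + K}" "a \<in> {M * i' - K..M * i' + K}" for a i i'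
  proof (rule ccontr)
    assume "i \<noteq> i'"
    then have "1 \<le> \<bar>i - i'\<bar>" by linarith
    then have "M * 1 \<le> M * \<bar>i - i'\<bar>" using M K by (intro mult_left_mono) auto
    moreover have "\<bar>M * (i - i')\<bar> = M * \<bar>i - i'\<bar>" using M K by (simp add: abs_mult)
    moreover have "\<bar>M * (i - i')\<bar> \<le> 2 * K" using that by (auto simp: algebra_simps abs_le_iff)
    ultimately show False using M by linarith
  qed
  have finT: "finite T" by (rule finite_subset[of _ "{0..<int n} \<times> {0..<int n}"]) (auto simp: T_def)
  have le: "M * i + M \<le> int n * M \<and> 0 \<le> M * i" if "i \<in> {0..<int n}" for i
  proof -
    have "(i + 1) * M \<le> int n * M" using that M K by (intro mult_right_mono) auto
    then show ?thesis using that M K by (simp add: algebra_simps)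
  qed
  have "card T \<le> card {z \<in> \<Lambda>. \<exists>w. w \<notin> \<Lambda> \<and> (z, w) \<in> ?R}"
  proof (rule card_trifurcations_le[where B = B])
    show "sym ?R" by (rule sym_grid_rel)
    show "finite \<Lambda>" by (simp add: \<Lambda>_def)
    show "B s \<inter> B t = {}" if "s \<noteq> t" for s t
      using that apart by (cases s; cases t) (fastforce simp: B)
    show "trifurcation ?R (B t)" if "t \<in> T" for t
      using that by (auto simp: T_def B_def)
    show "?R `` B t \<subseteq> \<Lambda>" if "t \<in> T" for t
    proof
      fix y assume "y \<in> ?R `` B t"
      then obtain x where x: "x \<in> B t" "(x, y) \<in> ?R" by blast
      obtain i j where t: "t = (i, j)" by (cases t)
      have "i \<in> {0..<int n}" "j \<in> {0..<int n}" using that by (auto simp: T_def t)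
      note ij = le[OF this(1)] le[OF this(2)]
      have "lo \<le> fst y \<and> fst y \<le> hi \<and> lo \<le> snd y \<and> snd y \<le> hi"
        using ij grid_rel_neighbours[OF x(2)] x(1) M K unfolding t B lo_def hi_def atLeastAtMost_iff
        by linarith
      then show "y \<in> \<Lambda>" by (simp add: \<Lambda>_def mem_Times_iff)
    qed
  qed (rule finT)
  also have "\<dots> \<le> card F"
  proof (rule card_mono)
    show "{z \<in> \<Lambda>. \<exists>w. w \<notin> \<Lambda> \<and> (z, w) \<in> ?R} \<subseteq> F"
    proof
      fix z assume "z \<in> {z \<in> \<Lambda>. \<exists>w. w \<notin> \<Lambda> \<and> (z, w) \<in> ?R}"
      then obtain w where z: "z \<in> \<Lambda>" "w \<notin> \<Lambda>" "(z, w) \<in> ?R" by blast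
      then show "z \<in> F" using grid_rel_neighbours[OF z(3)]
        by (cases z; cases w) (auto simp: \<Lambda>_def F_def)
    qed
  qed (simp add: F_def)
  also have "\<dots> \<le> card ({lo, hi} \<times> {lo..hi}) + card ({lo..hi} \<times> {lo, hi})"
    unfolding F_def by (rule card_Un_le)
  also have "\<dots> = 2 * (card {lo, hi} * nat (hi - lo + 1))"
    by (simp add: card_cartesian_product algebra_simps)
  also have "\<dots> \<le> 2 * (2 * nat (hi - lo + 1))"
    by (intro mult_left_mono mult_right_mono) (auto simp: card_insert_le_m1)
  also have "\<dots> = 4 * nat (int n * M + 2 * K + 3)" by (simp add: lo_def hi_def algebra_simps)
  finally show ?thesis by (simp add: T_def)
qed

text \<open>Each of the three clusters is infinite and meets the box, so it has an infinite branch
  outside. The branches stay infinite and separated because nothing changes outside the box.\<close>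

lemma trifurcation_flips:
  assumes D: "D \<subseteq> box_faces K" and conn: "connected_within (grid_rel (flips D c)) (box K)"
    and sep: "separate_infinite_clusters (grid_rel c) x y z" and box: "x \<in> box K" "y \<in> box K" "z \<in> box K"
  shows "trifurcation (grid_rel (flips D c)) (box K)"
proof -
  let ?R = "grid_rel c" and ?R' = "grid_rel (flips D c)"
  have ex: "\<exists>a. infinite_branch_at ?R' (box K) a \<and> (u, a) \<in> ?R\<^sup>*"
    if u: "u \<in> box K" "infinite_cluster ?R u" for u
  proof -
    obtain b a where ba: "b \<in> box K" "a \<notin> box K" "(b, a) \<in> ?R" "(u, b) \<in> ?R\<^sup>*"
      "infinite ((avoiding ?R (box K))\<^sup>* `` {a})"
      using infinite_branch[OF finite_grid_rel_Image finite_box u(1)] u(2)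
      unfolding infinite_cluster_def by blast
    then have "infinite_branch_at ?R' (box K) a"
      using avoiding_box_flips[OF D] grid_rel_flips_outside[OF D]
      by (auto simp: infinite_branch_at_def)
    then show ?thesis using ba by (meson rtrancl.rtrancl_into_rtrancl)
  qed
  obtain a1 a2 a3 where
    a1: "infinite_branch_at ?R' (box K) a1" "(x, a1) \<in> ?R\<^sup>*" and
    a2: "infinite_branch_at ?R' (box K) a2" "(y, a2) \<in> ?R\<^sup>*" and
    a3: "infinite_branch_at ?R' (box K) a3" "(z, a3) \<in> ?R\<^sup>*"
    using ex[OF box(1)] ex[OF box(2)] ex[OF box(3)] sep
    unfolding separate_infinite_clusters_def by metis
  have "(a, a') \<notin> (avoiding ?R (box K))\<^sup>*"
    if "(u, a) \<in> ?R\<^sup>*" "(u', a') \<in> ?R\<^sup>*" "(u, u') \<notin> ?R\<^sup>*" for u u' a a'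
    using that rtrancl_avoiding_subset rtrancl_symD[OF sym_grid_rel] by (metis rtrancl_trans subsetD)
  then show ?thesis
    using a1 a2 a3 sep conn
    unfolding trifurcation_def avoiding_box_flips[OF D] separate_infinite_clusters_def by blast
qed

text \<open>An infinite cluster that misses the box after the change was one before, different from
  those of \<open>x\<close> and \<open>y\<close> since these meet the box: a third one, which
  \<open>nosep\<close> forbids. So every infinite cluster meets the box, which is connected.\<close>

lemma merge_flips:
  assumes D: "D \<subseteq> box_faces K" and conn: "connected_within (grid_rel (flips D c)) (box K)"
    and nosep: "\<And>x y z. \<not> separate_infinite_clusters (grid_rel c) x y z"
    and xy: "x \<in> box K" "y \<in> box K" "infinite_cluster (grid_rel c) x" "infinite_cluster (grid_rel c) y"
      "(x, y) \<notin> (grid_rel c)\<^sup>*"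
  shows "\<not> two_infinite_clusters (grid_rel (flips D c))"
proof
  let ?R = "grid_rel c" and ?R' = "grid_rel (flips D c)"
  have hit: "\<exists>b\<in>box K. (u, b) \<in> ?R'\<^sup>*" if u: "infinite_cluster ?R' u" for u
  proof (rule ccontr)
    assume no: "\<not> (\<exists>b\<in>box K. (u, b) \<in> ?R'\<^sup>*)"
    have into: "(u, z) \<in> ?R\<^sup>*" if "(u, z) \<in> ?R'\<^sup>*" for z
      using that by (rule rtrancl_restrict) (use no grid_rel_flips_outside[OF D] in blast)
    have conv: "(u, z) \<in> ?R'\<^sup>*" if "(u, z) \<in> ?R\<^sup>*" for z
      using that
    proof (induction rule: rtrancl_induct)
      case (step v w)
      then have "(v, w) \<in> ?R'" using no grid_rel_flips_outside[OF D] by blast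
      then show ?case using step by (meson rtrancl.rtrancl_into_rtrancl)
    qed simp
    have "?R\<^sup>* `` {u} = ?R'\<^sup>* `` {u}" using into conv by blast
    then have "infinite_cluster ?R u" using u by (simp add: infinite_cluster_def)
    moreover have "(u, x) \<notin> ?R\<^sup>*" "(u, y) \<notin> ?R\<^sup>*" using no xy conv by blast+
    ultimately show False using nosep[of u x y] xy by (simp add: separate_infinite_clusters_def)
  qed
  assume "two_infinite_clusters ?R'"
  then obtain u v where uv: "infinite_cluster ?R' u" "infinite_cluster ?R' v" "(u, v) \<notin> ?R'\<^sup>*"
    by (auto simp: two_infinite_clusters_def)
  obtain b b' where b: "b \<in> box K" "(u, b) \<in> ?R'\<^sup>*" "b' \<in> box K" "(v, b') \<in> ?R'\<^sup>*"
    using hit uv by blast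
  have "(b, b') \<in> (?R' \<inter> box K \<times> box K)\<^sup>*" using conn b by (auto simp: connected_within_def)
  then have "(b, b') \<in> ?R'\<^sup>*" by (meson in_rtrancl_UnI inf_le1 rtrancl_mono subsetD)
  then show False using uv(3) b rtrancl_symD[OF sym_grid_rel] by (metis rtrancl_trans)
qed

section \<open>Uniqueness of the infinite cluster\<close>

definition edge_space :: "edge_config measure" where
  "edge_space = Pi\<^sub>M UNIV (\<lambda>_. count_space UNIV)"

lemma space_edge_space [simp]: "space edge_space = UNIV"
  by (simp add: edge_space_def space_PiM)

lemma pred_edge [measurable]: "Measurable.pred edge_space (\<lambda>c. c e)"
  unfolding edge_space_def by (rule measurable_component_singleton) simp

lemma measurable_edge_spaceI:
  assumes "\<And>e. Measurable.pred M (\<lambda>\<omega>. f \<omega> e)"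
  shows "f \<in> M \<rightarrow>\<^sub>M edge_space"
  unfolding edge_space_def
  using measurable_PiM_single'[of UNIV "\<lambda>e \<omega>. f \<omega> e" M "\<lambda>_. count_space UNIV"] assms by simp

lemma pred_rtrancl:
  fixes r :: "'c \<Rightarrow> ('a::countable) rel"
  assumes [measurable]: "\<And>x y. Measurable.pred M (\<lambda>c. (x, y) \<in> r c)"
  shows "Measurable.pred M (\<lambda>c. (x, y) \<in> (r c)\<^sup>*)"
proof -
  have [measurable]: "Measurable.pred M (\<lambda>c. (x, y) \<in> r c ^^ n)" for n y
  proof (induction n arbitrary: y)
    case (Suc n)
    note Suc [measurable]
    have "(\<lambda>c. (x, y) \<in> r c ^^ Suc n) = (\<lambda>c. \<exists>z. (x, z) \<in> r c ^^ n \<and> (z, y) \<in> r c)" by auto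
    then show ?case by simp
  qed simp
  show ?thesis unfolding rtrancl_power by measurable
qed

text \<open>Infinite means that the codes under \<open>to_nat\<close> are unbounded; this leaves
  only quantifiers over countable types.\<close>

lemma pred_infinite_cluster:
  fixes r :: "'c \<Rightarrow> ('a::countable) rel"
  assumes "\<And>x y. Measurable.pred M (\<lambda>c. (x, y) \<in> r c)"
  shows "Measurable.pred M (\<lambda>c. infinite_cluster (r c) x)"
proof -
  note pred_rtrancl[OF assms, measurable]
  have "infinite_cluster (r c) x \<longleftrightarrow> (\<forall>m. \<exists>n\<ge>m. \<exists>y. n = to_nat y \<and> (x, y) \<in> (r c)\<^sup>*)" for c
  proof -
    have "infinite_cluster (r c) x \<longleftrightarrow> infinite (to_nat ` ((r c)\<^sup>* `` {x}))"
      unfolding infinite_cluster_def by (simp add: finite_image_iff)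
    also have "\<dots> \<longleftrightarrow> (\<forall>m. \<exists>n\<ge>m. n \<in> to_nat ` ((r c)\<^sup>* `` {x}))"
      by (rule infinite_nat_iff_unbounded_le)
    finally show ?thesis by (simp add: image_iff Bex_def conj_commute)
  qed
  then show ?thesis by simp
qed

lemma pred_grid_rel [measurable]: "Measurable.pred edge_space (\<lambda>c. (x, y) \<in> grid_rel c)"
  by (cases x; cases y) (simp add: grid_rel_def)

lemma pred_avoiding [measurable]: "Measurable.pred edge_space (\<lambda>c. (x, y) \<in> avoiding (grid_rel c) B)"
  by (simp add: avoiding_def)

lemmas [measurable] =
  pred_rtrancl[OF pred_grid_rel] pred_rtrancl[OF pred_avoiding]
  pred_infinite_cluster[OF pred_grid_rel] pred_infinite_cluster[OF pred_avoiding]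

lemma pred_separate [measurable]:
  "Measurable.pred edge_space (\<lambda>c. separate_infinite_clusters (grid_rel c) x y z)"
  unfolding separate_infinite_clusters_def by measurable

lemma pred_two_infinite_clusters [measurable]:
  "Measurable.pred edge_space (\<lambda>c. two_infinite_clusters (grid_rel c))"
  unfolding two_infinite_clusters_def by measurable

lemma pred_trifurcation:
  assumes "finite B"
  shows "Measurable.pred edge_space (\<lambda>c. trifurcation (grid_rel c) B)"
proof -
  have [measurable]: "countable B" using assms by (rule countable_finite)
  have "Measurable.pred edge_space (\<lambda>c. (x, y) \<in> grid_rel c \<inter> B \<times> B)" for x y by simp
  from pred_rtrancl[OF this] have [measurable]:
    "Measurable.pred edge_space (\<lambda>c. (x, y) \<in> (grid_rel c \<inter> B \<times> B)\<^sup>*)" for x y .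
  have [measurable]: "Measurable.pred edge_space (\<lambda>c. infinite_branch_at (grid_rel c) B a)" for a
    unfolding infinite_branch_at_def infinite_cluster_def[symmetric] by measurable
  show ?thesis unfolding trifurcation_def connected_within_def by measurable
qed

lemma measurable_flips [measurable]: "flips D \<in> edge_space \<rightarrow>\<^sub>M edge_space"
proof (rule measurable_edge_spaceI)
  fix e show "Measurable.pred edge_space (\<lambda>c. flips D c e)"
    by (cases e) (simp add: flips_def)
qed

lemma measurable_shift_config [measurable]: "shift_config s t \<in> edge_space \<rightarrow>\<^sub>M edge_space"
proof (rule measurable_edge_spaceI)
  fix e show "Measurable.pred edge_space (\<lambda>c. shift_config s t c e)"
    by (cases e) (simp add: shift_config_def)
qed

text \<open>A translation by \<open>k\<close> here is one by \<open>2 * k\<close> in the original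
  coordinates, since neighbouring primal vertices are two units apart. Positivity is stated for
  preimages, which are measurable; \<open>flips {S}\<close> is an involution, so they coincide with
  images.\<close>

locale even_percolation = prob_space P for P :: "edge_config measure" +
  fixes k :: int
  assumes k: "k \<ge> 1"
    and sets_P [measurable_cong]: "sets P = sets edge_space"
    and even: "AE c in P. even_config c"
    and shift_invariant: "\<And>i j A. A \<in> sets P \<Longrightarrow> emeasure P (shift_config (k * i) (k * j) -` A) = emeasure P A"
    and ergodic: "\<And>A. A \<in> sets P \<Longrightarrow> (\<And>i j. shift_config (k * i) (k * j) -` A = A) \<Longrightarrow>
      emeasure P A = 0 \<or> emeasure P A = 1"
    and flip_positive: "\<And>S A. A \<in> sets P \<Longrightarrow> emeasure P A > 0 \<Longrightarrow> emeasure P (flips {S} -` A) > 0"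
begin

lemma space_P [simp]: "space P = UNIV"
  using sets_eq_imp_space_eq[OF sets_P] by simp

lemma vimage_flips_sets: "A \<in> sets P \<Longrightarrow> flips D -` A \<in> sets P"
  using measurable_sets[OF measurable_flips, of A D] by (simp add: sets_P)

lemma flips_positive:
  assumes "finite D" "A \<in> sets P" "emeasure P A > 0"
  shows "emeasure P (flips D -` A) > 0"
  using assms
proof (induction D arbitrary: A rule: finite_induct)
  case empty
  then show ?case by (simp add: flips_empty vimage_def)
next
  case (insert S D)
  have "flips (insert S D) -` A = flips D -` (flips {S} -` A)"
    by (simp add: vimage_def flips_insert[OF insert.hyps(2)])
  then show ?case using insert flip_positive vimage_flips_sets by simp
qed

text \<open>If \<open>T\<close> were null, so would be its preimage under each
  \<open>flips D\<close>, because flipping back leads to \<open>T\<close> again. Finitely many of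
  these preimages cover almost all of \<open>E\<close>, so \<open>D\<close> may vary with
  \<open>c\<close>.\<close>

lemma modification:
  assumes E: "E \<in> sets P" "emeasure P E > 0" and T: "T \<in> sets P"
    and mod: "\<And>c. c \<in> E \<Longrightarrow> even_config c \<Longrightarrow> \<exists>D\<subseteq>box_faces K. flips D c \<in> T"
  shows "emeasure P T > 0"
proof (rule ccontr)
  assume "\<not> emeasure P T > 0"
  then have T0: "emeasure P T = 0" by simp
  have "AE c in P. flips D c \<notin> T" if "D \<subseteq> box_faces K" for D
  proof -
    have fin: "finite D" using that finite_box_faces finite_subset by blast
    have "emeasure P (flips D -` T) = 0"
    proof (rule ccontr)
      assume "emeasure P (flips D -` T) \<noteq> 0"
      then have "emeasure P (flips D -` (flips D -` T)) > 0"
        using flips_positive[OF fin vimage_flips_sets[OF T]] by (simp add: zero_less_iff_neq_zero)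
      moreover have "flips D -` (flips D -` T) = T" by (auto simp: flips_flips)
      ultimately show False using T0 by simp
    qed
    then have "flips D -` T \<in> null_sets P" using vimage_flips_sets[OF T] by blast
    from AE_not_in[OF this] show ?thesis by simp
  qed
  then have "AE c in P. \<forall>D\<in>Pow (box_faces K). flips D c \<notin> T"
    using finite_box_faces by (intro AE_finite_allI) auto
  with even have "AE c in P. c \<notin> E"
  proof eventually_elim
    case (elim c)
    then show ?case using mod[of c] by blast
  qed
  then have "E \<in> null_sets P" using E(1) by (simp add: AE_iff_null_sets)
  then show False using E(2) by auto
qed

lemma trifurcation_null:
  assumes K: "K \<ge> 0"
  shows "emeasure P {c. trifurcation (grid_rel c) (box K)} = 0"
proof -
  \<comment> \<open>A multiple of \<open>k\<close>, for invariance, and at least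
    \<open>2 * K + 1\<close>, for disjoint boxes.\<close>
  define M where "M = k * (2 * K + 1)"
  have M: "M \<ge> 2 * K + 1" using k K mult_right_mono[of 1 k "2 * K + 1"] by (simp add: M_def)
  define T where "T i j = {c. trifurcation (grid_rel c) (translate (M * i) (M * j) ` box K)}" for i j
  have T_sets [measurable]: "T i j \<in> sets P" for i j
    using pred_trifurcation[of "translate (M * i) (M * j) ` box K"] finite_box
    by (simp add: T_def pred_def sets_P)
  have T_int: "integrable P (indicator (T i j) :: _ \<Rightarrow> real)" for i j
    by (rule integrable_real_indicator[OF T_sets]) (simp add: emeasure_eq_measure)
  define p where "p = prob {c. trifurcation (grid_rel c) (box K)}"
  have p_le: "p \<le> prob (T i j)" for i j
  proof -
    let ?A = "{c. trifurcation (grid_rel c) (box K)}"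
    have A: "?A \<in> sets P" using pred_trifurcation[OF finite_box] by (simp add: pred_def sets_P)
    have "shift_config (M * i) (M * j) -` ?A \<subseteq> T i j"
      using trifurcation_inv_image[OF bij_translate] by (auto simp: T_def grid_rel_shift_config)
    moreover have "emeasure P (shift_config (M * i) (M * j) -` ?A) = emeasure P ?A"
      using shift_invariant[OF A, of "(2 * K + 1) * i" "(2 * K + 1) * j"] by (simp add: M_def mult.assoc)
    ultimately have "emeasure P ?A \<le> emeasure P (T i j)" using emeasure_mono[OF _ T_sets] by metis
    then show ?thesis by (simp add: p_def emeasure_eq_measure)
  qed
  have bound: "(real n)\<^sup>2 * p \<le> 4 * (real n * M + 2 * K + 3)" for n
  proof -
    let ?I = "{0..<int n} \<times> {0..<int n}"
    have "(real n)\<^sup>2 * p = (\<Sum>(i, j)\<in>?I. p)"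
      by (simp add: case_prod_unfold card_cartesian_product power2_eq_square)
    also have "\<dots> \<le> (\<Sum>(i, j)\<in>?I. prob (T i j))"
      using p_le by (intro sum_mono) auto
    also have "\<dots> = expectation (\<lambda>c. \<Sum>(i, j)\<in>?I. indicator (T i j) c)"
      by (subst Bochner_Integration.integral_sum) (auto simp: case_prod_unfold T_int)
    also have "\<dots> \<le> expectation (\<lambda>c. 4 * (real n * M + 2 * K + 3))"
    proof (rule integral_mono)
      fix c
      have "(\<Sum>(i, j)\<in>?I. indicator (T i j) c :: real) = (\<Sum>x\<in>?I. if c \<in> T (fst x) (snd x) then 1 else 0)"
        by (intro sum.cong) (auto simp: indicator_def)
      also have "\<dots> = card (?I \<inter> {x. c \<in> T (fst x) (snd x)})"
        by (subst sum.If_cases) auto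
      also have "?I \<inter> {x. c \<in> T (fst x) (snd x)} = {(i, j). (i, j) \<in> ?I \<and> c \<in> T i j}" by auto
      finally have "(\<Sum>(i, j)\<in>?I. indicator (T i j) c :: real) = card {(i, j). (i, j) \<in> ?I \<and> c \<in> T i j}" .
      also have "\<dots> \<le> real (4 * nat (int n * M + 2 * K + 3))"
        using card_trifurcation_boxes[OF M K, of n c] by (simp add: T_def)
      also have "\<dots> = 4 * (real n * M + 2 * K + 3)"
        using M K by simp
      finally show "(\<Sum>(i, j)\<in>?I. indicator (T i j) c) \<le> 4 * (real n * M + 2 * K + 3)" .
    qed (auto simp: case_prod_unfold T_int)
    also have "\<dots> = 4 * (real n * M + 2 * K + 3)" using prob_space by simp
    finally show ?thesis .
  qed
  have "p \<le> 0"
  proof (rule ccontr)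
    assume "\<not> p \<le> 0"
    then have p: "p > 0" by simp
    \<comment> \<open>For \<open>n \<ge> 1\<close> the linear bound is at most \<open>n * b\<close>,
      which \<open>n\<^sup>2 * p\<close> exceeds once \<open>n > b / p\<close>.\<close>
    define b :: real where "b = 4 * (M + 2 * K + 3)"
    obtain n where n: "real n > b / p" using reals_Archimedean2 by blast
    have b: "b > 0" using M K by (simp add: b_def)
    have "b / p > 0" using b p by simp
    then have "real n > 0" using n by linarith
    then have n1: "real n \<ge> 1" by simp
    have grow: "1 * (2 * real_of_int K + 3) \<le> real n * (2 * real_of_int K + 3)"
      using n1 K by (intro mult_right_mono) auto
    have "(real n)\<^sup>2 * p \<le> 4 * (real n * M + 2 * K + 3)" by (rule bound)
    also have "\<dots> \<le> 4 * (real n * M + real n * (2 * K + 3))"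
      using grow by simp
    also have "\<dots> = real n * b" by (simp add: b_def algebra_simps)
    finally have "real n * (real n * p) \<le> real n * b" by (simp add: power2_eq_square mult.assoc)
    then have "real n * p \<le> b" using n1 by simp
    then show False using n p by (simp add: field_simps)
  qed
  then show ?thesis by (simp add: p_def emeasure_eq_measure measure_le_0_iff)
qed

text \<open>There are countably many triples, so the three points may be fixed; a box that does not
  depend on the configuration then contains them.\<close>

lemma AE_not_separate: "AE c in P. \<forall>x y z. \<not> separate_infinite_clusters (grid_rel c) x y z"
proof -
  have "AE c in P. \<not> separate_infinite_clusters (grid_rel c) x y z" for x y z
  proof (rule ccontr)
    assume not: "\<not> ?thesis"
    define E where "E = {c. separate_infinite_clusters (grid_rel c) x y z}"
    have E: "E \<in> sets P" using pred_separate by (simp add: E_def pred_def sets_P)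
    have "E \<notin> null_sets P" using not E by (simp add: AE_iff_null_sets E_def)
    then have pos: "emeasure P E > 0" using E by (auto simp: null_sets_def zero_less_iff_neq_zero)
    obtain K where K: "K \<ge> 2" "{x, y, z} \<subseteq> box K" using exists_box[of "{x, y, z}"] by blast
    have "emeasure P {c. trifurcation (grid_rel c) (box K)} > 0"
    proof (rule modification[OF E pos])
      show "{c. trifurcation (grid_rel c) (box K)} \<in> sets P"
        using pred_trifurcation[OF finite_box] by (simp add: pred_def sets_P)
      fix c assume c: "c \<in> E" "even_config c"
      obtain D where "D \<subseteq> box_faces K" "connected_within (grid_rel (flips D c)) (box K)"
        using connecting_flips[OF c(2) K(1)] .
      then show "\<exists>D\<subseteq>box_faces K. flips D c \<in> {c. trifurcation (grid_rel c) (box K)}"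
        using trifurcation_flips[of D K c x y z] c K by (auto simp: E_def)
    qed
    then show False using trifurcation_null[of K] K by simp
  qed
  then show ?thesis by (simp add: AE_all_countable)
qed

theorem AE_not_two_infinite_clusters: "AE c in P. \<not> two_infinite_clusters (grid_rel c)"
proof (rule ccontr)
  assume not: "\<not> ?thesis"
  define A where "A = {c. two_infinite_clusters (grid_rel c)}"
  have A: "A \<in> sets P" using pred_two_infinite_clusters by (simp add: A_def pred_def sets_P)
  have "A \<notin> null_sets P" using not A by (simp add: AE_iff_null_sets A_def)
  then have "emeasure P A \<noteq> 0" using A by (simp add: null_sets_def)
  moreover have "shift_config s t -` A = A" for s t
    by (auto simp: A_def grid_rel_shift_config two_infinite_clusters_inv_image[OF bij_translate])
  ultimately have A1: "emeasure P A = 1" using ergodic[OF A] by blast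
  obtain x y where xy: "\<not> (AE c in P. \<not> (infinite_cluster (grid_rel c) x \<and>
      infinite_cluster (grid_rel c) y \<and> (x, y) \<notin> (grid_rel c)\<^sup>*))"
  proof (rule ccontr)
    assume "\<not> thesis"
    then have "AE c in P. \<not> (infinite_cluster (grid_rel c) x \<and>
      infinite_cluster (grid_rel c) y \<and> (x, y) \<notin> (grid_rel c)\<^sup>*)" for x y using that by blast
    then have "AE c in P. \<forall>x y. \<not> (infinite_cluster (grid_rel c) x \<and>
      infinite_cluster (grid_rel c) y \<and> (x, y) \<notin> (grid_rel c)\<^sup>*)"
      unfolding AE_all_countable by blast
    then have "AE c in P. \<not> two_infinite_clusters (grid_rel c)"
      by eventually_elim (auto simp: two_infinite_clusters_def)
    then show False using not by blast
  qed
  \<comment> \<open>Excluding three clusters costs only a null set and ensures that every infinite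
    cluster meets the box after the change.\<close>
  define Q where "Q c \<longleftrightarrow> infinite_cluster (grid_rel c) x \<and> infinite_cluster (grid_rel c) y \<and>
     (x, y) \<notin> (grid_rel c)\<^sup>* \<and> (\<forall>u v w. \<not> separate_infinite_clusters (grid_rel c) u v w)" for c
  have [measurable]: "Measurable.pred edge_space Q" unfolding Q_def by measurable
  define E where "E = {c. Q c}"
  have E: "E \<in> sets P" unfolding E_def using \<open>Measurable.pred edge_space Q\<close> by (simp add: pred_def sets_P)
  have "E \<notin> null_sets P"
  proof
    assume "E \<in> null_sets P"
    from AE_not_in[OF this] AE_not_separate have "AE c in P. \<not> (infinite_cluster (grid_rel c) x \<and>
      infinite_cluster (grid_rel c) y \<and> (x, y) \<notin> (grid_rel c)\<^sup>*)"
      by eventually_elim (auto simp: E_def Q_def)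
    then show False using xy by blast
  qed
  then have pos: "emeasure P E > 0" using E by (auto simp: null_sets_def zero_less_iff_neq_zero)
  obtain K where K: "K \<ge> 2" "{x, y} \<subseteq> box K" using exists_box[of "{x, y}"] by blast
  have "emeasure P (- A) > 0"
  proof (rule modification[OF E pos])
    show "- A \<in> sets P" using sets.compl_sets[OF A] by (simp add: Compl_eq_Diff_UNIV)
    fix c assume c: "c \<in> E" "even_config c"
    obtain D where "D \<subseteq> box_faces K" "connected_within (grid_rel (flips D c)) (box K)"
      using connecting_flips[OF c(2) K(1)] .
    then show "\<exists>D\<subseteq>box_faces K. flips D c \<in> - A"
      using merge_flips[of D K c x y] c K by (auto simp: E_def Q_def A_def)
  qed
  moreover have "emeasure P (- A) = 0"
    using prob_compl[OF A] A1 by (simp add: Compl_eq_Diff_UNIV emeasure_eq_measure)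
  ultimately show False by simp
qed

end

section \<open>Primal contours as clusters\<close>

definition double :: "int \<times> int \<Rightarrow> int \<times> int" where
  "double = (\<lambda>(i, j). (2 * i, 2 * j))"

definition primal_edge :: "bool \<times> int \<times> int \<Rightarrow> (int \<times> int) set" where
  "primal_edge = (\<lambda>(d, i, j). {double (i, j), double (if d then (i + 1, j) else (i, j + 1))})"

definition primal :: "config \<Rightarrow> edge_config" where
  "primal \<omega> = (\<lambda>e. phi \<omega> (primal_edge e))"

lemma inj_double: "inj double"
  by (auto simp: inj_def double_def)

lemma inj_primal_edge: "primal_edge e = primal_edge e' \<longleftrightarrow> e = e'"
  by (cases e; cases e') (auto simp: primal_edge_def double_def doubleton_eq_iff)

lemma L1_edges_eq: "L1_edges = range primal_edge"
proof (intro equalityI subsetI)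
  fix e assume "e \<in> L1_edges"
  then obtain u v where uv: "e = {u, v}" "L1_vertex u" "L1_vertex v" "dist2 u v"
    by (auto simp: L1_edges_def)
  obtain i j where u: "u = (2 * i, 2 * j)" using uv(2) by (cases u) (auto simp: L1_vertex_def elim!: evenE)
  obtain i' j' where v: "v = (2 * i', 2 * j')" using uv(3) by (cases v) (auto simp: L1_vertex_def elim!: evenE)
  define a b where "a = i' - i" and "b = j' - j"
  have ab: "i' = i + a" "j' = j + b" by (simp_all add: a_def b_def)
  have sq: "a\<^sup>2 + b\<^sup>2 = 1" using uv(4) by (simp add: dist2_def u v ab power2_eq_square algebra_simps)
  then have "a\<^sup>2 \<le> 1" "b\<^sup>2 \<le> 1" using zero_le_power2[of a] zero_le_power2[of b] by linarith+
  then have "\<bar>a\<bar> \<le> 1" "\<bar>b\<bar> \<le> 1" by (simp_all add: abs_square_le_1)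
  then have "a \<in> {-1, 0, 1}" "b \<in> {-1, 0, 1}" by auto
  with sq consider "a = 1" "b = 0" | "a = -1" "b = 0" | "a = 0" "b = 1" | "a = 0" "b = -1" by auto
  then show "e \<in> range primal_edge"
  proof cases
    case 1
    then have "e = primal_edge (True, i, j)" by (simp add: primal_edge_def double_def uv(1) u v ab)
    then show ?thesis by simp
  next
    case 2
    then have "e = primal_edge (True, i', j')"
      by (simp add: primal_edge_def double_def uv(1) u v ab insert_commute)
    then show ?thesis by simp
  next
    case 3
    then have "e = primal_edge (False, i, j)" by (simp add: primal_edge_def double_def uv(1) u v ab)
    then show ?thesis by simp
  next
    case 4
    then have "e = primal_edge (False, i', j')"
      by (simp add: primal_edge_def double_def uv(1) u v ab insert_commute)
    then show ?thesis by simp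
  qed
next
  fix e assume "e \<in> range primal_edge"
  then obtain d i j where "e = primal_edge (d, i, j)" by auto
  then show "e \<in> L1_edges"
    unfolding L1_edges_def mem_Collect_eq
    by (intro exI[of _ "double (i, j)"] exI[of _ "double (if d then (i + 1, j) else (i, j + 1))"])
      (auto simp: primal_edge_def double_def L1_vertex_def dist2_def)
qed

lemma primal_horizontal: "primal \<omega> (True, i, j) \<longleftrightarrow> tb_split \<omega> (2 * i, 2 * j)"
proof
  assume "primal \<omega> (True, i, j)"
  then show "tb_split \<omega> (2 * i, 2 * j)"
    by (auto simp: primal_def phi_def primal_edge_def double_def hedge_def vedge_def doubleton_eq_iff)
next
  assume "tb_split \<omega> (2 * i, 2 * j)"
  then show "primal \<omega> (True, i, j)"
    unfolding primal_def phi_def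
    by (intro exI[of _ "(2 * i, 2 * j)"]) (simp add: black_face_def primal_edge_def double_def hedge_def)
qed

text \<open>The black face \<open>(a, b)\<close> whose vertical edge joins
  \<open>(2 * i, 2 * j)\<close> to \<open>(2 * i, 2 * j + 2)\<close> has
  \<open>a + 1 = 2 * i\<close> and \<open>b - 1 = 2 * j\<close>.\<close>

lemma primal_vertical: "primal \<omega> (False, i, j) \<longleftrightarrow> lr_split \<omega> (2 * i - 1, 2 * j + 1)"
proof
  assume "primal \<omega> (False, i, j)"
  then obtain a b where ab: "(double (i, j) = (a + 1, b - 1) \<and> double (i, j + 1) = (a + 1, b + 1)) \<and> lr_split \<omega> (a, b)"
    by (auto simp: primal_def phi_def primal_edge_def double_def hedge_def vedge_def doubleton_eq_iff)
  then have "a = 2 * i - 1" "b = 2 * j + 1" by (auto simp: double_def)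
  then show "lr_split \<omega> (2 * i - 1, 2 * j + 1)" using ab by simp
next
  assume "lr_split \<omega> (2 * i - 1, 2 * j + 1)"
  then show "primal \<omega> (False, i, j)"
    unfolding primal_def phi_def
    by (intro exI[of _ "(2 * i - 1, 2 * j + 1)"])
      (simp add: black_face_def primal_edge_def double_def vedge_def algebra_simps)
qed

text \<open>The six patterns are those with an even number of 1s, except the two alternating ones:
  opposite sides of the face agree or disagree together, and the two pairs never disagree at once.
  So one side already tells whether the edge crossing it is present.\<close>

lemma Omega_splits:
  assumes "\<omega> \<in> Omega" "even (a + b)"
  shows "tb_split \<omega> (a, b) \<longleftrightarrow> \<omega> (a, b) \<noteq> \<omega> (a, b + 1)"
    "tb_split \<omega> (a, b) \<longleftrightarrow> \<omega> (a + 1, b) \<noteq> \<omega> (a + 1, b + 1)"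
    "lr_split \<omega> (a, b) \<longleftrightarrow> \<omega> (a, b) \<noteq> \<omega> (a + 1, b)"
    "lr_split \<omega> (a, b) \<longleftrightarrow> \<omega> (a, b + 1) \<noteq> \<omega> (a + 1, b + 1)"
proof -
  have "black_face (a, b)" using assms(2) by (simp add: black_face_def)
  then have "face_states \<omega> (a, b) \<in>
      {[False,False,False,False], [True,True,True,True], [False,False,True,True],
       [True,True,False,False], [False,True,True,False], [True,False,False,True]}"
    using assms(1) unfolding Omega_def by blast
  then show "tb_split \<omega> (a, b) \<longleftrightarrow> \<omega> (a, b) \<noteq> \<omega> (a, b + 1)"
    "tb_split \<omega> (a, b) \<longleftrightarrow> \<omega> (a + 1, b) \<noteq> \<omega> (a + 1, b + 1)"
    "lr_split \<omega> (a, b) \<longleftrightarrow> \<omega> (a, b) \<noteq> \<omega> (a + 1, b)"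
    "lr_split \<omega> (a, b) \<longleftrightarrow> \<omega> (a, b + 1) \<noteq> \<omega> (a + 1, b + 1)"
    by (auto simp: face_states_def tb_split_def lr_split_def)
qed

text \<open>The four edges at an L1 vertex cross the four sides of the white face around it.\<close>

lemma even_config_primal:
  assumes "\<omega> \<in> Omega"
  shows "even_config (primal \<omega>)"
proof -
  \<comment> \<open>Each edge records a change of state along one side of the white face with
    lower-left corner \<open>(2 * i - 1, 2 * j)\<close>; a closed walk around this face has an even
    number of changes.\<close>
  have "(tb_split \<omega> (2 * i, 2 * j) \<noteq> tb_split \<omega> (2 * (i - 1), 2 * j)) =
    (lr_split \<omega> (2 * i - 1, 2 * j + 1) \<noteq> lr_split \<omega> (2 * i - 1, 2 * (j - 1) + 1))" for i j
    using Omega_splits(1)[OF assms, of "2 * i" "2 * j"] Omega_splits(2)[OF assms, of "2 * (i - 1)" "2 * j"]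
      Omega_splits(3)[OF assms, of "2 * i - 1" "2 * j + 1"]
      Omega_splits(4)[OF assms, of "2 * i - 1" "2 * (j - 1) + 1"]
    by (auto simp: algebra_simps)
  then show ?thesis by (simp add: even_config_def primal_horizontal primal_vertical)
qed

lemma primal_shift:
  "primal (shift (2 * s, 2 * t) \<omega>) = shift_config s t (primal \<omega>)"
proof
  fix e :: "bool \<times> int \<times> int"
  obtain d i j where e: "e = (d, i, j)" by (cases e)
  show "primal (shift (2 * s, 2 * t) \<omega>) e = shift_config s t (primal \<omega>) e"
    by (cases d) (simp_all add: e shift_config_def primal_horizontal primal_vertical
        tb_split_def lr_split_def shift_def algebra_simps)
qed

lemma pred_config [measurable]: "Measurable.pred config_space (\<lambda>\<omega>. \<omega> x)"
  unfolding config_space_def by (rule measurable_component_singleton) simp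

lemma measurable_primal [measurable]: "primal \<in> config_space \<rightarrow>\<^sub>M edge_space"
proof (rule measurable_edge_spaceI)
  fix e :: "bool \<times> int \<times> int"
  obtain d i j where e: "e = (d, i, j)" by (cases e)
  show "Measurable.pred config_space (\<lambda>\<omega>. primal \<omega> e)"
    by (cases d) (simp_all add: e primal_horizontal primal_vertical tb_split_def lr_split_def)
qed

lemma space_config_space [simp]: "space config_space = UNIV"
  by (simp add: config_space_def space_PiM)

lemma measurable_restrict_phi [measurable]:
  "(\<lambda>\<omega>. restrict (phi \<omega>) L1_edges) \<in> config_space \<rightarrow>\<^sub>M L1_conf_space"
  unfolding L1_conf_space_def
proof (rule measurable_restrict)
  fix e assume "e \<in> L1_edges"
  then obtain e' where e': "e = primal_edge e'" by (auto simp: L1_edges_eq)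
  have "Measurable.pred config_space (\<lambda>\<omega>. primal \<omega> e')"
    by (rule measurable_compose[OF measurable_primal pred_edge])
  then show "(\<lambda>\<omega>. phi \<omega> e) \<in> config_space \<rightarrow>\<^sub>M count_space UNIV" by (simp add: primal_def e')
qed

lemma measurable_relabel: "(\<lambda>\<psi> e. \<psi> (primal_edge e)) \<in> L1_conf_space \<rightarrow>\<^sub>M edge_space"
  by (rule measurable_edge_spaceI)
    (simp add: L1_conf_space_def L1_edges_eq measurable_component_singleton)

lemma relabel_flip_face:
  "(\<lambda>e. flip_face (double S) \<psi> (primal_edge e)) = flips {S} (\<lambda>e. \<psi> (primal_edge e))"
proof
  fix e :: "bool \<times> int \<times> int"
  obtain d a b where e: "e = (d, a, b)" by (cases e)
  obtain i j where S: "S = (i, j)" by (cases S)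
  have "L1_face_sides (double S) = primal_edge ` {(True, i, j), (True, i, j + 1), (False, i, j), (False, i + 1, j)}"
    by (auto simp: L1_face_sides_def double_def S primal_edge_def algebra_simps)
  then have "primal_edge e \<in> L1_face_sides (double S) \<longleftrightarrow>
      e \<in> {(True, i, j), (True, i, j + 1), (False, i, j), (False, i + 1, j)}"
    by (simp add: inj_primal_edge)
  also have "\<dots> \<longleftrightarrow> ((a, b) \<in> {S}) \<noteq> ((if d then (a, b - 1) else (a - 1, b)) \<in> {S})"
    by (auto simp: e S)
  finally show "flip_face (double S) \<psi> (primal_edge e) = flips {S} (\<lambda>e. \<psi> (primal_edge e)) e"
    by (simp add: flip_face_def L1_edges_eq e flips_def)
qed

section \<open>Contours compared with clusters\<close>

lemma double_grid_rel:
  "(x, y) \<in> grid_rel (primal \<omega>) \<Longrightarrow> {double x, double y} \<in> L1_edges \<inter> present_edges \<omega>"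
proof -
  assume "(x, y) \<in> grid_rel (primal \<omega>)"
  then have "(\<exists>i j. {x, y} = {(i, j), (i + 1, j)} \<and> primal \<omega> (True, i, j)) \<or>
      (\<exists>i j. {x, y} = {(i, j), (i, j + 1)} \<and> primal \<omega> (False, i, j))"
    by (cases x; cases y) (auto simp: grid_rel_def doubleton_eq_iff)
  then have "\<exists>d i j. {x, y} = {(i, j), if d then (i + 1, j) else (i, j + 1)} \<and> primal \<omega> (d, i, j)"
    unfolding ex_bool_eq by (simp only: if_True if_False)
  then obtain d i j where e: "{x, y} = {(i, j), if d then (i + 1, j) else (i, j + 1)}" "primal \<omega> (d, i, j)"
    by blast
  have "{double x, double y} = primal_edge (d, i, j)"
    using arg_cong[OF e(1), of "image double"] by (simp add: primal_edge_def)
  then show ?thesis using e(2) by (simp add: present_edges_def L1_edges_eq primal_def)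
qed

lemma present_L1_edgeE:
  assumes "e \<in> L1_edges" "e \<in> present_edges \<omega>"
  obtains x y where "e = {double x, double y}" "(x, y) \<in> grid_rel (primal \<omega>)"
proof -
  obtain d i j where e: "e = primal_edge (d, i, j)" using assms(1) by (auto simp: L1_edges_eq)
  have "primal \<omega> (d, i, j)" using assms(2) by (simp add: present_edges_def e primal_def)
  then have "((i, j), if d then (i + 1, j) else (i, j + 1)) \<in> grid_rel (primal \<omega>)"
    by (cases d) (auto simp: grid_rel_def)
  then show thesis using that e by (simp add: primal_edge_def)
qed

lemma sym_edge_adj: "sym (edge_adj \<omega>)"
  by (auto simp: sym_def edge_adj_def)

text \<open>A contour is infinite in edges, a cluster in vertices. All edges of \<open>C\<close> are
  subsets of the doubled cluster of \<open>x\<close>, and a finite cluster would allow only finitely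
  many.\<close>

lemma infinite_primal_contourE:
  assumes "infinite_primal_contour \<omega> C"
  obtains e x where "e \<in> present_edges \<omega>" "C = (edge_adj \<omega>)\<^sup>* `` {e}" "double x \<in> e"
    "infinite_cluster (grid_rel (primal \<omega>)) x"
proof -
  let ?R = "grid_rel (primal \<omega>)"
  obtain e where e: "e \<in> present_edges \<omega>" "C = (edge_adj \<omega>)\<^sup>* `` {e}"
    and C: "C \<subseteq> L1_edges" "infinite C"
    using assms by (auto simp: infinite_primal_contour_def contour_def Image_def)
  have "e \<in> C" using e(2) by simp
  then obtain x x' where x: "e = {double x, double x'}" "(x, x') \<in> ?R"
    using C(1) e(1) by (meson present_L1_edgeE subsetD)
  have reach: "\<forall>y. double y \<in> e' \<longrightarrow> (x, y) \<in> ?R\<^sup>*" if "(e, e') \<in> (edge_adj \<omega>)\<^sup>*" for e'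
    using that
  proof (induction rule: rtrancl_induct)
    case base
    then show ?case using x inj_double by (auto simp: inj_eq)
  next
    case (step e' e'')
    have "(e, e'') \<in> (edge_adj \<omega>)\<^sup>*" using step by (meson rtrancl.rtrancl_into_rtrancl)
    then have "e'' \<in> L1_edges" using e C by blast
    moreover have "e'' \<in> present_edges \<omega>" using step by (simp add: edge_adj_def)
    ultimately obtain z z' where z: "e'' = {double z, double z'}" "(z, z') \<in> ?R"
      by (rule present_L1_edgeE)
    have "e' \<inter> e'' \<noteq> {}" using step by (simp add: edge_adj_def)
    then have "(x, z) \<in> ?R\<^sup>* \<or> (x, z') \<in> ?R\<^sup>*" using z(1) step.IH by blast
    moreover have "(z', z) \<in> ?R" using z(2) sym_grid_rel by (meson symD)
    ultimately have "(x, z) \<in> ?R\<^sup>*" "(x, z') \<in> ?R\<^sup>*"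
      using z(2) by (meson rtrancl.rtrancl_into_rtrancl)+
    then show ?case using z(1) inj_double by (auto simp: inj_eq)
  qed
  have "C \<subseteq> Pow (double ` (?R\<^sup>* `` {x}))"
  proof
    fix e' assume e': "e' \<in> C"
    then have "e' \<subseteq> range double" using C(1) by (auto simp: L1_edges_eq primal_edge_def)
    then show "e' \<in> Pow (double ` (?R\<^sup>* `` {x}))" using reach[of e'] e' e(2) by blast
  qed
  then have "infinite_cluster ?R x"
    using C(2) finite_subset unfolding infinite_cluster_def by (metis finite_Pow_iff finite_imageI)
  then show thesis using that e x by blast
qed

text \<open>A path from \<open>x1\<close> to \<open>x2\<close> is a chain of present edges in which
  consecutive ones share a vertex, so it would join \<open>e1\<close> to \<open>e2\<close> and make
  the contours equal.\<close>

lemma two_infinite_primal_contours: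
  assumes "infinite_primal_contour \<omega> C1" "infinite_primal_contour \<omega> C2" "C1 \<noteq> C2"
  shows "two_infinite_clusters (grid_rel (primal \<omega>))"
proof -
  let ?R = "grid_rel (primal \<omega>)"
  obtain e1 x1 where e1: "e1 \<in> present_edges \<omega>" "C1 = (edge_adj \<omega>)\<^sup>* `` {e1}" "double x1 \<in> e1"
    "infinite_cluster ?R x1" using infinite_primal_contourE[OF assms(1)] .
  obtain e2 x2 where e2: "e2 \<in> present_edges \<omega>" "C2 = (edge_adj \<omega>)\<^sup>* `` {e2}" "double x2 \<in> e2"
    "infinite_cluster ?R x2" using infinite_primal_contourE[OF assms(2)] .
  have "(x1, x2) \<notin> ?R\<^sup>*"
  proof
    have join: "\<forall>e\<in>present_edges \<omega>. double y \<in> e \<longrightarrow> (e1, e) \<in> (edge_adj \<omega>)\<^sup>*"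
      if "(x1, y) \<in> ?R\<^sup>*" for y
      using that
    proof (induction rule: rtrancl_induct)
      case base
      have "(e1, e) \<in> edge_adj \<omega>" if "e \<in> present_edges \<omega>" "double x1 \<in> e" for e
        using that e1 by (auto simp: edge_adj_def)
      then show ?case by blast
    next
      case (step y z)
      let ?f = "{double y, double z}"
      have f: "?f \<in> present_edges \<omega>" using double_grid_rel step(2) by blast
      have "(?f, e) \<in> edge_adj \<omega>" if "e \<in> present_edges \<omega>" "double z \<in> e" for e
        using that f by (auto simp: edge_adj_def)
      moreover have "(e1, ?f) \<in> (edge_adj \<omega>)\<^sup>*" using step.IH f by blast
      ultimately show ?case by (meson rtrancl.rtrancl_into_rtrancl)
    qed
    assume "(x1, x2) \<in> ?R\<^sup>*"
    then have e12: "(e1, e2) \<in> (edge_adj \<omega>)\<^sup>*" using join e2 by blast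
    then have "(e2, e1) \<in> (edge_adj \<omega>)\<^sup>*" using rtrancl_symD[OF sym_edge_adj] by blast
    then have "C1 = C2" using e12 unfolding e1(2) e2(2) by (auto intro: rtrancl_trans)
    then show False using assms(3) by blast
  qed
  then show ?thesis using e1(4) e2(4) unfolding two_infinite_clusters_def by blast
qed

lemma even_percolation_primal:
  fixes k :: nat and \<mu> :: "config measure"
  assumes k: "k \<ge> 1" and "prob_space \<mu>" and sets: "sets \<mu> = sets config_space"
    and Omega: "AE \<omega> in \<mu>. \<omega> \<in> Omega" and "Ak1 k \<mu>" and "Ak2 k \<mu>" and "A4 \<mu>"
  shows "even_percolation (distr \<mu> edge_space primal) (int k)"
proof -
  interpret prob_space \<mu> by fact
  note sets [measurable_cong]
  have space [simp]: "space \<mu> = UNIV" using sets_eq_imp_space_eq[OF sets] by simp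
  have primal [measurable]: "primal \<in> \<mu> \<rightarrow>\<^sub>M edge_space" by measurable
  define P where "P = distr \<mu> edge_space primal"
  have P: "emeasure P A = emeasure \<mu> (primal -` A)" if "A \<in> sets edge_space" for A
    using that by (simp add: P_def emeasure_distr)
  have vim: "primal -` A \<in> sets \<mu>" if "A \<in> sets edge_space" for A
    using measurable_sets[OF primal that] by simp
  have shift: "primal -` (shift_config (int k * i) (int k * j) -` A) =
      shift (2 * int k * i, 2 * int k * j) -` (primal -` A)" for i j A
    using primal_shift[of "int k * i" "int k * j"] by (auto simp: mult.assoc)
  have vim_shift: "shift_config s t -` A \<in> sets edge_space" if "A \<in> sets edge_space" for s t A
    using measurable_sets[OF measurable_shift_config that] by simp
  have vim_flips: "flips D -` A \<in> sets edge_space" if "A \<in> sets edge_space" for D A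
    using measurable_sets[OF measurable_flips that] by simp
  let ?g = "\<lambda>\<psi> e. \<psi> (primal_edge e)"
  \<comment> \<open>\<open>nu1 \<mu>\<close> and \<open>P\<close> are one law on two index sets,
    edges as vertex pairs and edges as labels; \<open>?g\<close> translates between them.\<close>
  have nu1: "emeasure (nu1 \<mu>) (?g -` A \<inter> space L1_conf_space) = emeasure P A"
    if "A \<in> sets edge_space" for A
  proof -
    have f: "(\<lambda>\<omega>. restrict (phi \<omega>) L1_edges) \<in> \<mu> \<rightarrow>\<^sub>M L1_conf_space" by measurable
    have "(\<lambda>\<omega>. restrict (phi \<omega>) L1_edges) -` (?g -` A \<inter> space L1_conf_space) = primal -` A"
      using measurable_space[OF f] by (auto simp: primal_def L1_edges_eq)
    then show ?thesis
      unfolding nu1_def using measurable_sets[OF measurable_relabel that] f that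
      by (simp add: emeasure_distr P)
  qed
  have "even_percolation P (int k)"
  proof (intro even_percolation.intro even_percolation_axioms.intro)
    show "prob_space P" unfolding P_def by (rule prob_space_distr) measurable
    show "int k \<ge> 1" using k by simp
    show setsP: "sets P = sets edge_space" by (simp add: P_def)
    have "AE \<omega> in \<mu>. even_config (primal \<omega>)"
      using Omega by eventually_elim (rule even_config_primal)
    moreover have "Measurable.pred edge_space even_config" unfolding even_config_def by measurable
    ultimately show "AE c in P. even_config c"
      unfolding P_def by (subst AE_distr_iff) (auto simp: pred_def)
    show "emeasure P (shift_config (int k * i) (int k * j) -` A) = emeasure P A"
      if "A \<in> sets P" for i j A
      using that \<open>Ak1 k \<mu>\<close> vim[of A] vim_shift by (simp add: setsP P shift Ak1_def)
    show "emeasure P A = 0 \<or> emeasure P A = 1"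
      if A: "A \<in> sets P" "\<And>i j. shift_config (int k * i) (int k * j) -` A = A" for A
    proof -
      have "shift (2 * int k * i, 2 * int k * j) -` (primal -` A) \<inter> space \<mu> = primal -` A" for i j
        using shift[of i j A] A(2) by simp
      then show ?thesis using \<open>Ak2 k \<mu>\<close> vim[of A] A(1) by (simp add: setsP P Ak2_def)
    qed
    show "emeasure P (flips {S} -` A) > 0" if "A \<in> sets P" "emeasure P A > 0" for S A
    proof -
      have A: "A \<in> sets edge_space" using that setsP by simp
      let ?E = "?g -` A \<inter> space L1_conf_space"
      let ?E' = "?g -` (flips {S} -` A) \<inter> space L1_conf_space"
      have E: "?E \<in> sets (nu1 \<mu>)" "?E' \<in> sets (nu1 \<mu>)"
        using measurable_sets[OF measurable_relabel A]
          measurable_sets[OF measurable_relabel vim_flips[OF A]] by (simp_all add: nu1_def)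
      have "L1_vertex (double S)" by (cases S) (simp add: L1_vertex_def double_def)
      moreover have "0 < emeasure (nu1 \<mu>) ?E" using that(2) nu1[OF A] by simp
      ultimately have "0 < emeasure (nu1 \<mu>) (flip_face (double S) ` ?E)"
        using \<open>A4 \<mu>\<close> E(1) unfolding A4_def by blast
      \<comment> \<open>(A4) speaks of the image, whose measurability is not at hand; it lies in the
        measurable set \<open>?E'\<close> because flipping twice gives back the
        configuration.\<close>
      also have "flip_face (double S) ` ?E \<subseteq> ?E'"
      proof
        fix \<psi>' assume "\<psi>' \<in> flip_face (double S) ` ?E"
        then obtain \<psi> where \<psi>: "\<psi>' = flip_face (double S) \<psi>" "?g \<psi> \<in> A" by blast
        have "\<psi>' \<in> space L1_conf_space"
          unfolding \<psi>(1) flip_face_def L1_conf_space_def space_PiM by (simp add: restrict_PiE)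
        moreover have "flips {S} (?g \<psi>') = ?g \<psi>"
          unfolding \<psi>(1) relabel_flip_face flips_flips ..
        ultimately show "\<psi>' \<in> ?E'" using \<psi>(2) by simp
      qed
      then have "emeasure (nu1 \<mu>) (flip_face (double S) ` ?E) \<le> emeasure (nu1 \<mu>) ?E'"
        using E(2) by (rule emeasure_mono)
      also have "\<dots> = emeasure P (flips {S} -` A)" by (rule nu1[OF vim_flips[OF A]])
      finally show ?thesis .
    qed
  qed
  then show ?thesis by (simp add: P_def)
qed

theorem theorem1p4:
  fixes k :: nat and \<mu> :: "config measure"
  assumes "k \<ge> 1"
    and "prob_space \<mu>"
    and "sets \<mu> = sets config_space"
    and "AE \<omega> in \<mu>. \<omega> \<in> Omega"
    and "Ak1 k \<mu>" and "Ak2 k \<mu>" and "A4 \<mu>"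
  shows "AE \<omega> in \<mu>. \<forall>C1 C2. infinite_primal_contour \<omega> C1 \<and> infinite_primal_contour \<omega> C2
            \<longrightarrow> C1 = C2"
proof -
  interpret even_percolation "distr \<mu> edge_space primal" "int k"
    using assms by (rule even_percolation_primal)
  have "primal \<in> \<mu> \<rightarrow>\<^sub>M edge_space"
    using measurable_primal measurable_cong_sets[OF assms(3) refl] by blast
  from AE_distrD[OF this AE_not_two_infinite_clusters]
  show ?thesis by eventually_elim (use two_infinite_primal_contours in blast)
qed

end
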